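(* Let $\mathbb{K}$ be an algebraically closed field of characteristic $0$, $R=\mathbb{K}[x_0,\dots,x_n]$, and let $F=\ell_0^{a_0}\cdots\ell_k^{a_k}\cdot q\in R$ be a concise form of degree $\deg(F)=a_0+\cdots+a_k+2$, where $\ell_0,\dots,\ell_k\in R_1$ are pairwise different (non-proportional) nonzero linear forms, $a_0,\dots,a_k$ are positive integers and $q\in R_2$ is a quadratic form. Let $\mathcal{L}=\mathbb{P}(\langle \ell_0^\vee,\dots,\ell_k^\vee\rangle)\subset\mathbb{P}^n$ and assume $\dim\mathcal{L}=k$. Assume that $F$ satisfies the following condition: for every $2\le i\le\deg(F)-1$ and all nonzero linear forms $H_1,\dots,H_i\in S_1$ with $H_i\cdots H_1\in\mathrm{Ann}(F)$, if $\mathcal{L}\subset\mathrm{V}(H_i)$, then $H_{i-1}\cdots H_1[\ell_0^{a_0}\cdots\ell_k^{a_k}]=0$. Then the following hold. (i) If $Z\subset\mathbb{P}^n$ is a finite set of points with $I(Z)\subset\mathrm{Ann}(F)$, then $Z=Z_1\cup\cdots\cup Z_{\deg(F)}$ where, for every $i\in\{1,\dots,\deg(F)-1\}$, $Z_i$ is a set of $n-\dim\mathcal{L}$ linearly independent points such that $\langle Z_i\rangle\cap\mathcal{L}=\emptyset$. Consequently, $\mathrm{srk}(F)\ge(\deg(F)-1)(n-\dim\mathcal{L})$. (ii) Suppose $\dim\mathcal{L}>0$ and let $Z\subset\mathbb{P}^n$ be a finite set of points admitting a splitting $Z=Z_1\cup\cdots\cup Z_{\deg(F)}$ as in (i). If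 there is a hyperplane $\mathrm{V}(H)$, $0\ne H\in S_1$, containing $\langle Z_{\deg(F)}\rangle+\mathcal{L}$ and such that $H[q]^\vee\notin\mathcal{L}$, then $I(Z)\not\subset\mathrm{Ann}(F)$. (iii) $\mathrm{psrk}(F)\ge(\deg(F)-1)(n-\dim\mathcal{L})$.
   Context: The ring $S=\mathbb{K}[y_0,\dots,y_n]$ acts on $R=\mathbb{K}[x_0,\dots,x_n]$ by differentiation, $y_i[F]=\partial F/\partial x_i$, and $\mathrm{Ann}(F)=\{\delta\in S\mid\delta[F]=0\}$. A form $F$ is concise if $\mathrm{Ann}(F)_1=0$. For a nonzero linear form $\ell=a_0x_0+\cdots+a_nx_n$, $\ell^\vee=(a_0:\cdots:a_n)\in\mathbb{P}^n$ is the dual point. For $H\in S_1$, $\mathrm{V}(H)\subset\mathbb{P}^n$ is its zero locus; for $Z\subset\mathbb{P}^n$, $I(Z)\subset S$ is its homogeneous vanishing ideal and $\langle Z\rangle$ its projective linear span; a sum $A+B$ of linear subspaces of $\mathbb{P}^n$ denotes the linear span of $A\cup B$. (If $H\neq0$ and $\mathcal{L}\subset\mathrm{V}(H)$, conciseness guarantees $H[q]\ne0$, so $H[q]^\vee$ is defined.) All dimensions are projective. The symmetric rank $\mathrm{srk}(F)$ of a form $F$ of degree $d$ is the minimal $r$ such that there are $m_1,\dots,m_r\in R_1$ with $F\in\langle m_1^d,\dots,m_r^d\rangle$. The partially symmetric rank $\mathrm{psrk}(F)$ is the minimal $r$ such that there are $m_1,\dots,m_r\in R_1$ with $y_i[F]\in\langle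 m_1^{d-1},\dots,m_r^{d-1}\rangle$ for every $i\in\{0,\dots,n\}$. *)

theory Defs
  imports
    "HOL-Analysis.Cartesian_Space"
    "HOL-Library.Poly_Mapping"
    "HOL-Library.Extended_Nat"
    "HOL-Library.Disjoint_Sets"
    "HOL-Computational_Algebra.Polynomial"
begin

section \<open>Polynomials and the action by differentiation\<close>

text \<open>
  Polynomials in finitely many variables indexed by a finite type \<open>'v\<close>, so that
  \<open>CARD('v) = n + 1\<close>. Both \<open>R\<close> (variables \<open>x\<^sub>i\<close>) and \<open>S\<close> (variables \<open>y\<^sub>i\<close>) are
  represented by this type; a monomial is its exponent vector.
\<close>

type_synonym ('v, 'a) mpol = "('v \<Rightarrow>\<^sub>0 nat) \<Rightarrow>\<^sub>0 'a"

definition Var :: "'v \<Rightarrow> ('v, 'a::comm_ring_1) mpol" where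
  "Var i = Poly_Mapping.single (Poly_Mapping.single i 1) 1"

definition Const :: "'a \<Rightarrow> ('v, 'a::comm_ring_1) mpol" where
  "Const c = Poly_Mapping.single 0 c"

definition forms :: "nat \<Rightarrow> ('v::finite, 'a::comm_ring_1) mpol set" where
  "forms d = {f. \<forall>m \<in> Poly_Mapping.keys f. (\<Sum>i\<in>UNIV. Poly_Mapping.lookup m i) = d}"

definition eval :: "('v::finite, 'a::comm_ring_1) mpol \<Rightarrow> 'a ^ 'v \<Rightarrow> 'a" where
  "eval f v = (\<Sum>m\<in>Poly_Mapping.keys f.
     Poly_Mapping.lookup f m * (\<Prod>i\<in>UNIV. (v $ i) ^ Poly_Mapping.lookup m i))"

definition partial :: "'v \<Rightarrow> ('v, 'a::comm_ring_1) mpol \<Rightarrow> ('v, 'a) mpol" where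
  "partial i F = (\<Sum>b\<in>Poly_Mapping.keys F.
     Poly_Mapping.single (b - Poly_Mapping.single i 1)
       (of_nat (Poly_Mapping.lookup b i) * Poly_Mapping.lookup F b))"

text \<open>
  \<open>act \<delta> F\<close> is \<open>\<delta>[F]\<close>, the bilinear extension of
  \<open>y\<^sup>a[x\<^sup>b] = (\<Prod>i. b\<^sub>i (b\<^sub>i - 1) \<cdots> (b\<^sub>i - a\<^sub>i + 1)) x\<^sup>b\<^sup>-\<^sup>a\<close>; the falling factorial
  vanishes if \<open>a\<^sub>i > b\<^sub>i\<close>, where the subtraction of exponents would truncate.
  Below it is shown that this is the action of \<open>S\<close> as a ring with
  \<open>y\<^sub>i[F] = \<partial>F/\<partial>x\<^sub>i\<close>.
\<close>

definition dcoeff :: "('v::finite \<Rightarrow>\<^sub>0 nat) \<Rightarrow> ('v \<Rightarrow>\<^sub>0 nat) \<Rightarrow> nat" where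
  "dcoeff a b = (\<Prod>i\<in>UNIV. \<Prod>j<Poly_Mapping.lookup a i. Poly_Mapping.lookup b i - j)"

definition act :: "('v::finite, 'a::comm_ring_1) mpol \<Rightarrow> ('v, 'a) mpol \<Rightarrow> ('v, 'a) mpol" where
  "act \<delta> F = (\<Sum>a\<in>Poly_Mapping.keys \<delta>. \<Sum>b\<in>Poly_Mapping.keys F.
     Poly_Mapping.single (b - a)
       (Poly_Mapping.lookup \<delta> a * Poly_Mapping.lookup F b * of_nat (dcoeff a b)))"

lemma act_superset:
  assumes "finite A" "finite B" "Poly_Mapping.keys \<delta> \<subseteq> A" "Poly_Mapping.keys F \<subseteq> B"
  shows "act \<delta> F = (\<Sum>a\<in>A. \<Sum>b\<in>B.
     Poly_Mapping.single (b - a)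
       (Poly_Mapping.lookup \<delta> a * Poly_Mapping.lookup F b * of_nat (dcoeff a b)))"
proof -
  have "act \<delta> F = (\<Sum>a\<in>Poly_Mapping.keys \<delta>. \<Sum>b\<in>B.
     Poly_Mapping.single (b - a)
       (Poly_Mapping.lookup \<delta> a * Poly_Mapping.lookup F b * of_nat (dcoeff a b)))"
    unfolding act_def
    by (intro sum.cong refl sum.mono_neutral_left assms)
       (auto simp: in_keys_iff)
  also have "\<dots> = (\<Sum>a\<in>A. \<Sum>b\<in>B.
     Poly_Mapping.single (b - a)
       (Poly_Mapping.lookup \<delta> a * Poly_Mapping.lookup F b * of_nat (dcoeff a b)))"
    by (intro sum.mono_neutral_left assms) (auto simp: in_keys_iff)
  finally show ?thesis .
qed

lemma act_add_left: "act (\<delta> + \<epsilon>) F = act \<delta> F + act \<epsilon> F"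
  using keys_add[of \<delta> \<epsilon>]
  by (subst (1 2 3) act_superset[where A = "Poly_Mapping.keys \<delta> \<union> Poly_Mapping.keys \<epsilon>"
        and B = "Poly_Mapping.keys F"])
     (auto simp: lookup_add algebra_simps single_add sum.distrib)

lemma act_add_right: "act \<delta> (F + G) = act \<delta> F + act \<delta> G"
  using keys_add[of F G]
  by (subst (1 2 3) act_superset[where A = "Poly_Mapping.keys \<delta>"
        and B = "Poly_Mapping.keys F \<union> Poly_Mapping.keys G"])
     (auto simp: lookup_add algebra_simps single_add sum.distrib)

lemma act_zero_left [simp]: "act 0 F = 0" and act_zero_right [simp]: "act \<delta> 0 = 0"
  by (simp_all add: act_def)

lemma act_single:
  "act (Poly_Mapping.single a c) (Poly_Mapping.single b e) =
     Poly_Mapping.single (b - a) (c * e * of_nat (dcoeff a b))"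
  by (subst act_superset[where A = "{a}" and B = "{b}"]) auto

lemma dcoeff_zero: "dcoeff a b = 0" if "Poly_Mapping.lookup a i > Poly_Mapping.lookup b i"
proof -
  have "(\<Prod>j<Poly_Mapping.lookup a i. Poly_Mapping.lookup b i - j) = 0"
    using that by (intro prod_zero) auto
  then show ?thesis unfolding dcoeff_def by (intro prod_zero) auto
qed

lemma dcoeff_add: "dcoeff (a + a') b = dcoeff a' b * dcoeff a (b - a')"
proof -
  have *: "(\<Prod>j<x + y. (z::nat) - j) = (\<Prod>j<y. z - j) * (\<Prod>j<x. z - y - j)" for x y z
    by (induction x) (auto simp: algebra_simps)
  show ?thesis
    by (simp add: dcoeff_def lookup_add lookup_minus * prod.distrib)
qed

lemma mpol_induct [case_names single add]:
  fixes f :: "('v, 'a::comm_ring_1) mpol"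
  assumes single: "\<And>a c. P (Poly_Mapping.single a c)"
    and add: "\<And>f g. P f \<Longrightarrow> P g \<Longrightarrow> P (f + g)"
  shows "P f"
proof -
  have "P 0" using single[of 0 0] by simp
  have "P (\<Sum>a\<in>A. Poly_Mapping.single a (Poly_Mapping.lookup f a))" if "finite A" for A
    using that by induction (auto intro: assms \<open>P 0\<close>)
  moreover have "f = (\<Sum>a\<in>Poly_Mapping.keys f. Poly_Mapping.single a (Poly_Mapping.lookup f a))"
    by (rule poly_mapping_eqI)
       (simp add: lookup_sum lookup_single when_def sum.delta not_in_keys_iff_lookup_eq_zero)
  ultimately show ?thesis by (metis finite_keys)
qed

lemma act_mult: "act (\<delta> * \<epsilon>) F = act \<delta> (act \<epsilon> F)"
proof (induction \<delta> rule: mpol_induct)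
  case (add f g) then show ?case by (simp add: distrib_right act_add_left)
next
  case \<delta>: (single a c)
  show ?case
  proof (induction \<epsilon> rule: mpol_induct)
    case (add f g) then show ?case by (simp add: distrib_left act_add_left act_add_right)
  next
    case \<epsilon>: (single a' c')
    show ?case
    proof (induction F rule: mpol_induct)
      case (add f g) then show ?case by (simp add: act_add_right)
    next
      case (single b e)
      have "b - a' - a = b - (a + a')"
        by (rule poly_mapping_eqI) (simp add: lookup_minus lookup_add)
      then show ?case
        by (simp only: act_single mult_single dcoeff_add of_nat_mult) (simp only: mult_ac)
    qed
  qed
qed

lemma act_one [simp]: "act 1 F = F"
proof (induction F rule: mpol_induct)
  case (single b e)
  show ?case using act_single[of 0 1 b e] by (simp add: dcoeff_def)
qed (simp add: act_add_right)

lemma act_Const [simp]: "act (Const c) F = Const c * F"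
proof (induction F rule: mpol_induct)
  case (single b e)
  show ?case by (simp add: Const_def act_single mult_single dcoeff_def)
qed (simp add: act_add_right distrib_left)

lemma act_Var:
  fixes F :: "('v::finite, 'a::comm_ring_1) mpol"
  shows "act (Var i) F = partial i F"
proof -
  have "dcoeff (Poly_Mapping.single i 1) b = Poly_Mapping.lookup b i" for b :: "'v \<Rightarrow>\<^sub>0 nat"
  proof -
    have "(\<Prod>j<Poly_Mapping.lookup (Poly_Mapping.single i 1) k. Poly_Mapping.lookup b k - j)
        = (if k = i then Poly_Mapping.lookup b k else 1)" for k
      by (auto simp: lookup_single)
    then show ?thesis unfolding dcoeff_def by simp
  qed
  then show ?thesis
    unfolding partial_def
    by (subst act_superset[where A = "{Poly_Mapping.single i 1}" and B = "Poly_Mapping.keys F"])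
       (auto simp: Var_def mult.commute)
qed

definition Ann :: "('v::finite, 'a::comm_ring_1) mpol \<Rightarrow> ('v, 'a) mpol set" where
  "Ann F = {\<delta>. act \<delta> F = 0}"

definition concise :: "('v::finite, 'a::comm_ring_1) mpol \<Rightarrow> bool" where
  "concise F \<longleftrightarrow> Ann F \<inter> forms 1 = {0}"

definition poly_span :: "('v, 'a::comm_ring_1) mpol set \<Rightarrow> ('v, 'a) mpol set" where
  "poly_span = module.span (\<lambda>c f. Const c * f)"

definition ideal_gen :: "('v, 'a::comm_ring_1) mpol set \<Rightarrow> ('v, 'a) mpol set" where
  "ideal_gen = module.span (*)"

lemma module_Const: "module (\<lambda>c (f :: ('v, 'a::comm_ring_1) mpol). Const c * f)"
  by standard (simp_all add: Const_def algebra_simps single_add mult_single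
      flip: mult.assoc)

lemma module_times: "module ((*) :: 'a::comm_ring_1 \<Rightarrow> _)"
  by standard (simp_all add: algebra_simps)


section \<open>Projective space\<close>

text \<open>
  Points of \<open>\<bbbP>\<^sup>n\<close> are the one-dimensional linear subspaces of \<open>K\<^sup>n\<^sup>+\<^sup>1\<close>.
  Linear subspaces of \<open>\<bbbP>\<^sup>n\<close> are represented by their sets of points.
\<close>

type_synonym ('v, 'a) pt = "('a ^ 'v) set"

definition proj_point :: "'a::field ^ 'v \<Rightarrow> ('v::finite, 'a) pt" where
  "proj_point v = vec.span {v}"

definition proj_space :: "('v::finite, 'a::field) pt set" where
  "proj_space = {proj_point v | v. v \<noteq> 0}"

definition proj_span :: "('v::finite, 'a::field) pt set \<Rightarrow> ('v, 'a) pt set" where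
  "proj_span X = {p \<in> proj_space. p \<subseteq> vec.span (\<Union>X)}"

definition proj_sum ::
  "('v::finite, 'a::field) pt set \<Rightarrow> ('v, 'a) pt set \<Rightarrow> ('v, 'a) pt set" where
  "proj_sum A B = proj_span (A \<union> B)"

text \<open>Projective dimension of a linear subspace given by its set of points; \<open>-1\<close> for \<open>{}\<close>.\<close>

definition proj_dim :: "('v::finite, 'a::field) pt set \<Rightarrow> int" where
  "proj_dim A = int (vec.dim (\<Union>A)) - 1"

definition indep_points :: "('v::finite, 'a::field) pt set \<Rightarrow> bool" where
  "indep_points X \<longleftrightarrow>
     (\<exists>b. (\<forall>p\<in>X. b p \<noteq> 0 \<and> p = proj_point (b p)) \<and> vec.independent (b ` X))"

text \<open>The dual point \<open>\<ell>\<^sup>\<or>\<close> (meaningful for a nonzero linear form \<open>\<ell>\<close>).\<close>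

definition dual_point :: "('v::finite, 'a::field) mpol \<Rightarrow> ('v, 'a) pt" where
  "dual_point l = proj_point (\<chi> i. Poly_Mapping.lookup l (Poly_Mapping.single i 1))"

definition zero_locus :: "('v::finite, 'a::field) mpol \<Rightarrow> ('v, 'a) pt set" where
  "zero_locus f = {p \<in> proj_space. \<forall>v\<in>p. eval f v = 0}"

definition vanishing_ideal :: "('v::finite, 'a::field) pt set \<Rightarrow> ('v, 'a) mpol set" where
  "vanishing_ideal Z = ideal_gen (\<Union>e. {f \<in> forms e. Z \<subseteq> zero_locus f})"


section \<open>Ranks\<close>

text \<open>
  The argument \<open>d\<close> is the degree of the form \<open>F\<close>. The minimum is taken in
  \<open>enat\<close>, where \<open>Inf\<close> of a nonempty set of numbers is its least element. (In
  characteristic 0 the sets are nonempty, as the powers of linear forms span the forms.)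
\<close>

definition srk :: "nat \<Rightarrow> ('v::finite, 'a::field) mpol \<Rightarrow> enat" where
  "srk d F = Inf {enat r | r. \<exists>m. (\<forall>j\<in>{1..r}. m j \<in> forms 1) \<and>
     F \<in> poly_span ((\<lambda>j. m j ^ d) ` {1..r})}"

definition psrk :: "nat \<Rightarrow> ('v::finite, 'a::field) mpol \<Rightarrow> enat" where
  "psrk d F = Inf {enat r | r. \<exists>m. (\<forall>j\<in>{1..r}. m j \<in> forms 1) \<and>
     (\<forall>i. act (Var i) F \<in> poly_span ((\<lambda>j. m j ^ (d - 1)) ` {1..r}))}"


section \<open>The condition on \<open>F\<close> and the splittings\<close>

text \<open>
  Here \<open>M\<close> is the factor \<open>\<ell>\<^sub>0\<^sup>a\<^sup>0 \<cdots> \<ell>\<^sub>k\<^sup>a\<^sup>k\<close>, \<open>L\<close> is the linear space spanned by the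
  \<open>\<ell>\<^sub>i\<^sup>\<or>\<close> and \<open>d\<close> is the degree of \<open>F\<close>.
\<close>

definition ann_condition ::
  "nat \<Rightarrow> ('v::finite, 'a::field) mpol \<Rightarrow> ('v, 'a) mpol \<Rightarrow> ('v, 'a) pt set \<Rightarrow> bool" where
  "ann_condition d F M L \<longleftrightarrow>
     (\<forall>i\<in>{2..d - 1}. \<forall>H. (\<forall>j\<in>{1..i}. H j \<in> forms 1 \<and> H j \<noteq> 0) \<longrightarrow>
        (\<Prod>j=1..i. H j) \<in> Ann F \<longrightarrow> L \<subseteq> zero_locus (H i) \<longrightarrow>
        act (\<Prod>j=1..i - 1. H j) M = 0)"

text \<open>
  \<open>Z = Z\<^sub>1 \<union> \<cdots> \<union> Z\<^sub>d\<close>, where for \<open>i < d\<close> the set \<open>Z\<^sub>i\<close> consists of \<open>m\<close> linearly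
  independent points whose span does not meet \<open>L\<close>. Disjointness of the \<open>Z\<^sub>i\<close> is not
  part of this predicate.
\<close>

definition splitting ::
  "nat \<Rightarrow> nat \<Rightarrow> ('v::finite, 'a::field) pt set \<Rightarrow> ('v, 'a) pt set
     \<Rightarrow> (nat \<Rightarrow> ('v, 'a) pt set) \<Rightarrow> bool" where
  "splitting d m L Z Zs \<longleftrightarrow>
     Z = (\<Union>i\<in>{1..d}. Zs i) \<and>
     (\<forall>i\<in>{1..d - 1}. card (Zs i) = m \<and> indep_points (Zs i) \<and> proj_span (Zs i) \<inter> L = {})"

end

(* Write F = M q. Only products of linear forms are needed. If a hyperplane H_{i+1} contained L
   and all of Z except Z_1, ..., Z_i, then hyperplanes H_j through Z_j would give
   H_{i+1} ... H_1 in I(Z), so H_i ... H_1[M] = 0 by the condition on F (or H_1 = 0 by conciseness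
   if i = 0). But since <Z_j> is complementary to L, the H_j can be prescribed on L, and M is a
   monomial in independent linear forms, so they can be chosen with H_i ... H_1[M] nonzero. Hence
   the remaining points span modulo L and the next Z_{i+1} can be taken from them. The products
   involved have degree less than deg F, which yields the bound on psrk as well: y_j Q[F] = 0
   for all j implies Q[F] = 0 if Q[F] has positive degree.

   For the second part let p = H[q], so H[F] = M p. As p is not in L, some z in Z_1 occurs in p
   with respect to the basis Z_1 of V / L. The hyperplane through L and Z_1 - {z} maps M p to a
   nonzero multiple of M. As dim L > 0, a hyperplane through Z_2 and z is still nonzero on some
   l_i, and hyperplanes through Z_3, ..., Z_{d-1} can reduce M to a multiple of this l_i. *)

theory Submission
  imports Defs
begin

section \<open>The action of products of linear forms\<close>

lemma Const_zero [simp]: "Const 0 = 0" and Const_one [simp]: "Const 1 = 1"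
  by (simp_all add: Const_def single_one)

lemma Const_add: "Const (x + y) = Const x + Const y"
  by (simp add: Const_def single_add)

lemma Const_mult: "Const (x * y) = Const x * Const y"
  by (simp add: Const_def mult_single)

lemma Const_sum: "Const (sum f A) = (\<Sum>i\<in>A. Const (f i))"
  by (induction A rule: infinite_finite_induct) (simp_all add: Const_add)

lemma Const_of_nat: "Const (of_nat n) = of_nat n"
  by (induction n) (simp_all add: Const_add)

lemma Const_eq_0_iff [simp]: "Const c = 0 \<longleftrightarrow> c = 0"
  by (metis Const_def Const_zero lookup_single_eq lookup_zero)

lemma act_sum_left: "act (sum f A) F = (\<Sum>i\<in>A. act (f i) F)"
  by (induction A rule: infinite_finite_induct) (simp_all add: act_add_left)

lemma act_sum_right: "act \<delta> (sum f A) = (\<Sum>i\<in>A. act \<delta> (f i))"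
  by (induction A rule: infinite_finite_induct) (simp_all add: act_add_right)

lemma act_commute: "act \<delta> (act \<epsilon> F) = act \<epsilon> (act \<delta> F)"
  by (metis act_mult mult.commute)

lemma act_smult: "act \<delta> (Const c * F) = Const c * act \<delta> F"
  by (metis act_Const act_commute)

section \<open>Partial derivatives and the product rule\<close>

lemma partial_single:
  "partial i (Poly_Mapping.single b c) =
     Poly_Mapping.single (b - Poly_Mapping.single i 1) (of_nat (Poly_Mapping.lookup b i) * c)"
  by (cases "c = 0") (simp_all add: partial_def)

lemma partial_add:
  fixes F G :: "('v::finite, 'a::comm_ring_1) mpol"
  shows "partial i (F + G) = partial i F + partial i G"
  by (simp only: act_Var[symmetric] act_add_right)

text \<open>Both sides are additive in each factor, so single terms suffice.\<close>

lemma partial_mult: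
  fixes F G :: "('v::finite, 'a::comm_ring_1) mpol"
  shows "partial i (F * G) = partial i F * G + F * partial i G"
proof (induction F rule: mpol_induct)
  case (add f g) then show ?case by (simp add: partial_add algebra_simps)
next
  case F: (single b c)
  show ?case
  proof (induction G rule: mpol_induct)
    case (add f g) then show ?case by (simp add: partial_add algebra_simps)
  next
    case (single b' c')
    let ?e = "Poly_Mapping.single i (1::nat)"
    \<comment> \<open>Truncated subtraction of exponents is only correct where the exponent of
      \<open>i\<close> is positive; elsewhere the term has coefficient 0.\<close>
    have 1: "b + b' - ?e = (b - ?e) + b'" if "Poly_Mapping.lookup b i > 0"
      using that by (intro poly_mapping_eqI)
        (auto simp: lookup_add lookup_minus lookup_single when_def)
    have 2: "b + b' - ?e = b + (b' - ?e)" if "Poly_Mapping.lookup b' i > 0"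
      using that by (intro poly_mapping_eqI)
        (auto simp: lookup_add lookup_minus lookup_single when_def)
    show ?case
      using 1 2
      by (cases "Poly_Mapping.lookup b i = 0"; cases "Poly_Mapping.lookup b' i = 0")
         (simp_all add: partial_single mult_single lookup_add algebra_simps flip: single_add)
  qed
qed

section \<open>Homogeneous forms and Euler's identity\<close>

lemma forms_zero [simp]: "0 \<in> forms d"
  by (simp add: forms_def)

lemma forms_one: "1 \<in> forms 0"
  by (simp add: forms_def)

lemma forms_add: "f \<in> forms d \<Longrightarrow> g \<in> forms d \<Longrightarrow> f + g \<in> forms d"
  using keys_add[of f g] by (auto simp: forms_def)

lemma forms_mult: "f \<in> forms d \<Longrightarrow> g \<in> forms e \<Longrightarrow> f * g \<in> forms (d + e)"
  using keys_mult[of f g] by (fastforce simp: forms_def lookup_add sum.distrib)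

lemma forms_power: "f \<in> forms d \<Longrightarrow> f ^ e \<in> forms (e * d)"
  by (induction e) (auto simp: forms_one intro: forms_mult)

lemma forms_prod:
  "(\<And>i. i \<in> A \<Longrightarrow> f i \<in> forms (d i)) \<Longrightarrow> prod f A \<in> forms (sum d A)"
  by (induction A rule: infinite_finite_induct) (auto simp: forms_one intro: forms_mult)

lemma forms_sum: "(\<And>i. i \<in> A \<Longrightarrow> f i \<in> forms d) \<Longrightarrow> sum f A \<in> forms d"
  by (induction A rule: infinite_finite_induct) (auto intro: forms_add)

lemma forms_smult: "f \<in> forms d \<Longrightarrow> Const c * f \<in> forms d"
  using forms_mult[of "Const c" 0 f d] by (auto simp: Const_def forms_def)

lemma forms_partial:
  fixes F :: "('v::finite, 'a::comm_ring_1) mpol"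
  assumes "F \<in> forms d"
  shows "partial i F \<in> forms (d - 1)"
  unfolding partial_def
proof (rule forms_sum)
  fix b assume b: "b \<in> Poly_Mapping.keys F"
  let ?e = "Poly_Mapping.single i (1::nat)"
  show "Poly_Mapping.single (b - ?e)
     (of_nat (Poly_Mapping.lookup b i) * Poly_Mapping.lookup F b) \<in> forms (d - 1)"
  \<comment> \<open>A term without the variable \<open>i\<close> contributes 0, a form of every
    degree. This covers \<open>d = 0\<close>, where \<open>d - 1\<close> is truncated.\<close>
  proof (cases "Poly_Mapping.lookup b i = 0")
    case False
    have "b = (b - ?e) + ?e"
      using False by (intro poly_mapping_eqI)
        (auto simp: lookup_add lookup_minus lookup_single when_def)
    then have "(\<Sum>j\<in>UNIV. Poly_Mapping.lookup b j) =
        (\<Sum>j\<in>UNIV. Poly_Mapping.lookup (b - ?e) j) + (\<Sum>j\<in>UNIV. Poly_Mapping.lookup ?e j)"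
      by (metis (no_types, lifting) lookup_add sum.cong sum.distrib)
    moreover have "(\<Sum>j\<in>UNIV. Poly_Mapping.lookup ?e j) = 1"
      by (simp add: lookup_single when_def)
    moreover have "(\<Sum>j\<in>UNIV. Poly_Mapping.lookup b j) = d"
      using assms b by (auto simp: forms_def)
    ultimately show ?thesis by (simp add: forms_def)
  qed simp
qed

text \<open>Differentiating by a variable and multiplying by it again scales a monomial by the
  exponent of that variable, and the exponents add up to \<open>d\<close>.\<close>

lemma euler_forms:
  fixes F :: "('v::finite, 'a::comm_ring_1) mpol"
  assumes "F \<in> forms d"
  shows "(\<Sum>i\<in>UNIV. Var i * partial i F) = of_nat d * F"
proof -
  let ?s = "\<lambda>b. Poly_Mapping.single b (Poly_Mapping.lookup F b)"
  have *: "Var i * Poly_Mapping.single (b - Poly_Mapping.single i 1) (of_nat (Poly_Mapping.lookup b i) * c)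
     = of_nat (Poly_Mapping.lookup b i) * Poly_Mapping.single b c" for i and b :: "'v \<Rightarrow>\<^sub>0 nat" and c :: 'a
  proof (cases "Poly_Mapping.lookup b i = 0")
    case False
    then have "Poly_Mapping.single i 1 + (b - Poly_Mapping.single i 1) = b"
      by (intro poly_mapping_eqI) (auto simp: lookup_add lookup_minus lookup_single when_def)
    then show ?thesis
      by (simp only: Var_def mult_single Const_of_nat[symmetric] Const_def) simp
  qed simp
  have "(\<Sum>i\<in>UNIV. Var i * partial i F) =
      (\<Sum>i\<in>UNIV. \<Sum>b\<in>Poly_Mapping.keys F. of_nat (Poly_Mapping.lookup b i) * ?s b)"
    by (simp add: partial_def sum_distrib_left * del: One_nat_def)
  also have "\<dots> = (\<Sum>b\<in>Poly_Mapping.keys F. of_nat (\<Sum>i\<in>UNIV. Poly_Mapping.lookup b i) * ?s b)"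
    by (subst sum.swap) (simp add: sum_distrib_right)
  also have "\<dots> = of_nat d * (\<Sum>b\<in>Poly_Mapping.keys F. ?s b)"
    using assms by (simp add: forms_def sum_distrib_left)
  also have "(\<Sum>b\<in>Poly_Mapping.keys F. ?s b) = F"
    by (rule poly_mapping_eqI)
       (simp add: lookup_sum lookup_single when_def sum.delta not_in_keys_iff_lookup_eq_zero)
  finally show ?thesis .
qed

text \<open>By Euler's identity \<open>d\<close> times the form is 0, and \<open>d\<close> is
  invertible in characteristic 0. The bound on \<open>psrk\<close> passes from the partial
  derivatives back to \<open>F\<close> in this way.\<close>

lemma eq_0_if_partials_0:
  fixes F :: "('v::finite, 'a::field_char_0) mpol"
  assumes "F \<in> forms d" "d > 0" "\<And>i. partial i F = 0"
  shows "F = 0"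
proof -
  have "Const (of_nat d) * F = 0"
    using euler_forms[OF assms(1)] assms(3) by (simp add: Const_of_nat)
  then have "Const (inverse (of_nat d) * of_nat d) * F = 0"
    by (simp add: Const_mult mult.assoc)
  then show ?thesis using assms(2) by simp
qed

section \<open>Evaluation at a vector\<close>

lemma eval_superset:
  assumes "finite A" "Poly_Mapping.keys f \<subseteq> A"
  shows "eval f v = (\<Sum>m\<in>A. Poly_Mapping.lookup f m * (\<Prod>i\<in>UNIV. (v $ i) ^ Poly_Mapping.lookup m i))"
  unfolding eval_def using assms by (intro sum.mono_neutral_left) (auto simp: in_keys_iff)

lemma eval_add: "eval (f + g) v = eval f v + eval g v"
  using keys_add[of f g]
  by (subst (1 2 3) eval_superset[where A = "Poly_Mapping.keys f \<union> Poly_Mapping.keys g"])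
     (auto simp: lookup_add algebra_simps sum.distrib)

lemma eval_single:
  "eval (Poly_Mapping.single b c) v = c * (\<Prod>i\<in>UNIV. (v $ i) ^ Poly_Mapping.lookup b i)"
  by (subst eval_superset[where A = "{b}"]) auto

lemma eval_mult: "eval (f * g) v = eval f v * eval g v"
proof (induction f rule: mpol_induct)
  case (add f g) then show ?case by (simp add: distrib_right eval_add)
next
  case f: (single b c)
  show ?case
    by (induction g rule: mpol_induct)
       (simp_all add: distrib_left eval_add eval_single mult_single lookup_add power_add
         prod.distrib algebra_simps)
qed

lemma eval_sum: "eval (sum f A) v = (\<Sum>i\<in>A. eval (f i) v)"
  by (induction A rule: infinite_finite_induct) (auto simp: eval_add eval_def[of 0])

lemma eval_prod: "eval (prod f A) v = (\<Prod>i\<in>A. eval (f i) v)"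
proof -
  have "eval 1 v = 1" using eval_single[of 0 1 v] by simp
  then show ?thesis by (induction A rule: infinite_finite_induct) (auto simp: eval_mult)
qed

section \<open>Linear forms as coefficient vectors\<close>

definition lin :: "'a::comm_ring_1 ^ 'v \<Rightarrow> ('v::finite, 'a) mpol" where
  "lin h = (\<Sum>i\<in>UNIV. Const (h $ i) * Var i)"

definition coeff_vec :: "('v::finite, 'a::comm_ring_1) mpol \<Rightarrow> 'a ^ 'v" where
  "coeff_vec f = (\<chi> i. Poly_Mapping.lookup f (Poly_Mapping.single i 1))"

text \<open>One pairing serves both roles of a linear form of S: its value at a point and its action
  on a linear form of R.\<close>

definition dot :: "'a::comm_ring_1 ^ 'v \<Rightarrow> 'a ^ 'v::finite \<Rightarrow> 'a" where
  "dot v w = (\<Sum>i\<in>UNIV. v $ i * w $ i)"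

lemma dot_add_right: "dot v (w + x) = dot v w + dot v x"
  and dot_smult_right: "dot v (c *s w) = c * dot v w"
  and dot_zero_left [simp]: "dot 0 w = 0"
  and dot_zero_right [simp]: "dot v 0 = 0"
  by (simp_all add: dot_def algebra_simps sum.distrib sum_distrib_left)

lemma single_1_eq_iff:
  "Poly_Mapping.single i (Suc 0) = Poly_Mapping.single j (Suc 0) \<longleftrightarrow> i = j"
  by (metis lookup_single_eq lookup_single_not_eq nat.distinct(1))

lemma lin_alt:
  "lin h = (\<Sum>i\<in>UNIV. Poly_Mapping.single (Poly_Mapping.single i 1) (h $ i))"
  by (simp add: lin_def Const_def Var_def mult_single)

lemma coeff_vec_lin [simp]: "coeff_vec (lin h) = h"
  by (simp add: coeff_vec_def vec_eq_iff lin_alt lookup_sum lookup_single when_def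
      single_1_eq_iff)

lemma lin_forms: "lin h \<in> forms 1"
  unfolding lin_alt
  by (intro forms_sum) (auto simp: forms_def lookup_single when_def)

lemma lin_zero [simp]: "lin 0 = 0"
  by (simp add: lin_def)

lemma lin_eq_0_iff [simp]: "lin h = 0 \<longleftrightarrow> h = 0"
  by (metis coeff_vec_lin lin_zero)

lemma eval_lin: "eval (lin h) v = dot h v"
proof -
  have "(\<Prod>j\<in>UNIV. v $ j ^ (Poly_Mapping.lookup (Poly_Mapping.single i 1) j)) = v $ i" for i
  proof -
    have "(\<Prod>j\<in>UNIV. v $ j ^ (Poly_Mapping.lookup (Poly_Mapping.single i 1) j))
        = (\<Prod>j\<in>UNIV. if j = i then v $ i else 1)"
      by (intro prod.cong) (auto simp: lookup_single when_def)
    then show ?thesis by simp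
  qed
  then show ?thesis by (simp add: lin_alt eval_sum eval_single dot_def)
qed

text \<open>An exponent vector with sum 1 is a unit vector, so no other monomial occurs in
  \<open>f\<close>.\<close>

lemma lin_coeff_vec:
  fixes f :: "('v::finite, 'a::comm_ring_1) mpol"
  assumes "f \<in> forms 1" shows "lin (coeff_vec f) = f"
proof (rule poly_mapping_eqI)
  fix m :: "'v \<Rightarrow>\<^sub>0 nat"
  show "Poly_Mapping.lookup (lin (coeff_vec f)) m = Poly_Mapping.lookup f m"
  proof (cases "\<exists>i. m = Poly_Mapping.single i 1")
    case True
    then show ?thesis by (auto simp: lin_alt lookup_sum lookup_single when_def
      single_1_eq_iff coeff_vec_def)
  next
    case False
    have "m \<notin> Poly_Mapping.keys f"
    proof
      assume "m \<in> Poly_Mapping.keys f"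
      with assms have s: "(\<Sum>i\<in>UNIV. Poly_Mapping.lookup m i) = Suc 0" by (auto simp: forms_def)
      then obtain i where i: "Poly_Mapping.lookup m i = 1" "\<forall>j. j \<noteq> i \<longrightarrow> Poly_Mapping.lookup m j = 0"
        using sum_eq_Suc0_iff[of UNIV "Poly_Mapping.lookup m"] by auto
      then have "m = Poly_Mapping.single i 1"
        by (intro poly_mapping_eqI) (auto simp: lookup_single when_def)
      with False show False by auto
    qed
    then show ?thesis using False
      by (auto simp: lin_alt lookup_sum lookup_single when_def in_keys_iff intro!: sum.neutral)
  qed
qed

section \<open>Linear forms acting as derivations\<close>

lemma act_lin: "act (lin h) F = (\<Sum>i\<in>UNIV. Const (h $ i) * partial i F)"
  by (simp add: lin_def act_sum_left act_mult act_Var)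

lemma act_lin_mult: "act (lin h) (F * G) = act (lin h) F * G + F * act (lin h) G"
  by (simp add: act_lin partial_mult sum.distrib sum_distrib_left sum_distrib_right algebra_simps)

lemma act_lin_one [simp]: "act (lin h) 1 = 0"
  using act_lin_mult[of h 1 1] by simp

lemma partial_lin: "partial i (lin w) = Const (w $ i)"
proof -
  have "partial i (lin w) =
      (\<Sum>j\<in>UNIV. partial i (Poly_Mapping.single (Poly_Mapping.single j 1) (w $ j)))"
    by (simp only: lin_alt act_Var[symmetric] act_sum_right)
  also have "\<dots> = (\<Sum>j\<in>UNIV. if i = j then Const (w $ j) else 0)"
    by (intro sum.cong) (auto simp: partial_single lookup_single Const_def)
  finally show ?thesis by simp
qed

lemma act_lin_lin: "act (lin h) (lin w) = Const (dot h w)"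
  by (simp add: act_lin partial_lin dot_def Const_sum Const_mult)

lemma act_lin_power_0: "act (lin h) F = 0 \<Longrightarrow> act (lin h) (F ^ e) = 0"
  by (induction e) (auto simp: act_lin_mult)

lemma act_lin_prod_0:
  "(\<And>i. i \<in> A \<Longrightarrow> act (lin h) (f i) = 0) \<Longrightarrow> act (lin h) (prod f A) = 0"
  by (induction A rule: infinite_finite_induct) (auto simp: act_lin_mult)

lemma act_lin_power:
  "act (lin h) (F ^ Suc e) = of_nat (Suc e) * F ^ e * act (lin h) F"
  by (induction e) (simp_all add: act_lin_mult algebra_simps)

lemma forms_act_lin: "F \<in> forms d \<Longrightarrow> act (lin h) F \<in> forms (d - 1)"
  unfolding act_lin by (intro forms_sum forms_smult forms_partial)

lemma forms_act_prod_lin: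
  "finite A \<Longrightarrow> F \<in> forms d \<Longrightarrow> act (\<Prod>j\<in>A. lin (h j)) F \<in> forms (d - card A)"
proof (induction A rule: finite_induct)
  case (insert x A)
  then show ?case
    using forms_act_lin[of "act (\<Prod>j\<in>A. lin (h j)) F" "d - card A" "h x"]
    by (simp add: act_mult)
qed simp

section \<open>Linear functionals\<close>

lemma linear_functional_eq_dot:
  fixes f :: "'a::field ^ 'v::finite \<Rightarrow> 'a"
  assumes "Vector_Spaces.linear (*s) (*) f"
  shows "\<exists>h. \<forall>v. f v = dot h v"
proof (intro exI allI)
  interpret f: Vector_Spaces.linear "(*s)" "(*)" f by fact
  fix v
  have "f v = f (\<Sum>i\<in>UNIV. v $ i *s axis i 1)" by (simp add: basis_expansion)
  also have "\<dots> = (\<Sum>i\<in>UNIV. v $ i * f (axis i 1))" by (simp add: f.sum f.scale)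
  finally show "f v = dot (\<chi> i. f (axis i 1)) v" by (simp add: dot_def mult.commute)
qed

lemma dot_eq_0_span:
  assumes "v \<in> vec.span X" "\<And>x. x \<in> X \<Longrightarrow> dot h x = 0"
  shows "dot h v = 0"
  using assms by (induction rule: vec.span_induct_alt) (auto simp: dot_add_right dot_smult_right)

text \<open>Extend \<open>w\<close> and a basis of the span of \<open>X\<close> to a basis of the
  whole space and take the coordinate at \<open>w\<close>. All hyperplanes constructed below come
  from here.\<close>

lemma separating_functional:
  fixes w :: "'a::field ^ 'v::finite"
  assumes "w \<notin> vec.span X"
  obtains h where "\<And>x. x \<in> X \<Longrightarrow> dot h x = 0" "dot h w = 1"
proof -
  obtain B where B: "B \<subseteq> X" "vec.independent B" "X \<subseteq> vec.span B"
    by (rule vec.maximal_independent_subset)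
  have "w \<notin> vec.span B" using assms B(1) vec.span_mono by blast
  then have i: "vec.independent (insert w B)" using B(2) by (rule vec.independent_insertI)
  let ?E = "vec.extend_basis (insert w B)"
  have E: "vec.independent ?E" "insert w B \<subseteq> ?E"
    using vec.independent_extend_basis[OF i] vec.extend_basis_superset[OF i] by simp_all
  obtain h where h: "\<And>v. vec.representation ?E v w = dot h v"
    using linear_functional_eq_dot[OF vec.linear_representation[OF E(1) vec.span_extend_basis[OF i]]]
    by blast
  have b: "dot h b = (if w = b then 1 else 0)" if "b \<in> insert w B" for b
    using h[of b] vec.representation_basis[OF E(1), of b] E(2) that by auto
  have 1: "dot h w = 1" using b[of w] by simp
  have "dot h b = 0" if "b \<in> B" for b
    using b[of b] that \<open>w \<notin> vec.span B\<close> vec.span_base[of b B] by auto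
  then have "dot h x = 0" if "x \<in> X" for x
    using dot_eq_0_span B(3) that by blast
  with 1 show thesis using that by blast
qed

section \<open>Coordinates and independence\<close>

text \<open>Membership in \<open>vec.span (B - {c})\<close> says that the coordinate of
  \<open>v\<close> at \<open>c\<close> is 0; if this held for all \<open>c\<close> in
  \<open>C\<close>, then \<open>v\<close> would need only \<open>B - C\<close>.\<close>

lemma notin_span_delete:
  assumes "vec.independent B" "v \<in> vec.span B" "v \<notin> vec.span (B - C)"
  shows "\<exists>c\<in>C. v \<notin> vec.span (B - {c})"
proof (rule ccontr)
  assume "\<not> ?thesis"
  then have *: "v \<in> vec.span (B - {c})" if "c \<in> C" for c using that by blast
  let ?R = "vec.representation B v"
  have "?R c = 0" if "c \<in> C" for c
    using vec.representation_extend[OF assms(1) *[OF that]] vec.representation_ne_zero by fastforce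
  then have "{b. ?R b \<noteq> 0} \<subseteq> B - C" using vec.representation_ne_zero by fastforce
  then have "(\<Sum>b | ?R b \<noteq> 0. ?R b *s b) \<in> vec.span (B - C)"
    by (intro vec.span_sum vec.span_scale vec.span_base) auto
  then show False
    using assms(3) vec.sum_nonzero_representation_eq[OF assms(1,2)] by simp
qed

text \<open>The coordinates of \<open>v\<close> are supported both in \<open>C\<close> and in
  \<open>D\<close>, hence nowhere.\<close>

lemma span_disjoint_independent:
  assumes "vec.independent (C \<union> D)" "C \<inter> D = {}" "v \<in> vec.span C" "v \<in> vec.span D"
  shows "v = 0"
proof -
  have "vec.representation (C \<union> D) v = vec.representation C v"
       "vec.representation (C \<union> D) v = vec.representation D v"
    using assms by (auto intro!: vec.representation_extend)
  then have *: "{b. vec.representation C v b \<noteq> 0} = {}"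
    using assms(2) vec.representation_ne_zero by (metis (mono_tags, lifting) disjoint_iff empty_Collect_eq)
  have "vec.independent C" using assms(1) vec.independent_mono by blast
  from vec.sum_nonzero_representation_eq[OF this assms(3)] show ?thesis unfolding * by simp
qed

text \<open>By the dimension formula the union spans a space of dimension
  \<open>card C + card D\<close>, and it has at most that many elements.\<close>

lemma independent_Un_if_disjoint_spans:
  fixes C D :: "('a::field ^ 'v::finite) set"
  assumes C: "vec.independent C" and D: "vec.independent D"
    and disj: "\<And>v. v \<in> vec.span C \<Longrightarrow> v \<in> vec.span D \<Longrightarrow> v = 0"
  shows "vec.independent (C \<union> D)"
proof -
  have *: "vec.span C \<inter> vec.span D = {0}" using disj vec.span_zero by blast
  have "vec.dim (vec.span (C \<union> D)) + vec.dim (vec.span C \<inter> vec.span D)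
      = vec.dim (vec.span C) + vec.dim (vec.span D)"
    using vec.dim_sums_Int[OF vec.subspace_span[of C] vec.subspace_span[of D]]
    by (simp only: vec.span_Un)
  then have "vec.dim (vec.span (C \<union> D)) = card C + card D"
    using vec.dim_eq_card_independent[OF C] vec.dim_eq_card_independent[OF D]
    unfolding * by (simp add: vec.dim_insert)
  then have "card (C \<union> D) \<le> vec.dim (vec.span (C \<union> D))" by (simp add: card_Un_le)
  then show ?thesis
    using vec.card_le_dim_spanning[OF vec.span_superset order_refl]
      vec.finiteI_independent[OF C] vec.finiteI_independent[OF D] by blast
qed

section \<open>Derivatives of monomials in independent linear forms\<close>

text \<open>A functional dual to \<open>lv i\<close> acts as the derivative in the variable
  \<open>lin (lv i)\<close>: all other factors are constants for it.\<close>

lemma act_lin_monomial: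
  fixes lv :: "'i \<Rightarrow> 'a::comm_ring_1 ^ 'v::finite"
  assumes I: "finite I" "i \<in> I" and b: "b i > 0"
    and h: "dot h (lv i) = 1" "\<And>j. j \<in> I - {i} \<Longrightarrow> dot h (lv j) = 0"
  shows "act (lin h) (\<Prod>j\<in>I. lin (lv j) ^ b j) =
    Const (of_nat (b i)) * (\<Prod>j\<in>I. lin (lv j) ^ (b(i := b i - 1)) j)"
proof -
  let ?P = "\<Prod>j\<in>I - {i}. lin (lv j) ^ b j"
  obtain e where e: "b i = Suc e" using b gr0_implies_Suc by blast
  have "act (lin h) ?P = 0"
    by (intro act_lin_prod_0 act_lin_power_0) (simp add: act_lin_lin h)
  then have "act (lin h) (lin (lv i) ^ b i * ?P) =
      Const (of_nat (b i)) * (lin (lv i) ^ (b i - 1) * ?P)"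
    unfolding act_lin_mult e act_lin_power
    by (simp add: act_lin_lin h Const_of_nat mult.assoc del: of_nat_Suc)
  also have "?P = (\<Prod>j\<in>I - {i}. lin (lv j) ^ (b(i := b i - 1)) j)"
    by (intro prod.cong) auto
  finally show ?thesis
    using I by (simp add: prod.remove[of I i])
qed

text \<open>
  Each factor \<open>h j\<close> is chosen dual to one of the \<open>lv i\<close>, which makes the derivative a monomial
  again; there are \<open>b i\<close> such factors for every \<open>i\<close>.
\<close>

lemma ex_lin_product_reducing_monomial:
  fixes lv :: "'i \<Rightarrow> 'a::field_char_0 ^ 'v::finite"
  assumes "finite J" "finite I" "card J = sum b I"
    and "\<And>j i. j \<in> J \<Longrightarrow> i \<in> I \<Longrightarrow> lv i \<notin> vec.span (C j \<union> lv ` (I - {i}))"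
  shows "\<exists>h c. (\<forall>j\<in>J. \<forall>x\<in>C j. dot (h j) x = 0) \<and> c \<noteq> 0 \<and>
    act (\<Prod>j\<in>J. lin (h j)) (\<Prod>i\<in>I. lin (lv i) ^ (b i + b' i)) =
      Const c * (\<Prod>i\<in>I. lin (lv i) ^ b' i)"
  using assms(1,3,4)
proof (induction J arbitrary: b rule: finite_induct)
  case empty
  then have "(\<Prod>i\<in>I. lin (lv i) ^ (b i + b' i)) = (\<Prod>i\<in>I. lin (lv i) ^ b' i)"
    using assms(2) by (intro prod.cong) auto
  then show ?case by (intro exI[of _ undefined] exI[of _ 1]) auto
next
  case (insert x J)
  have "sum b I \<noteq> 0" using insert by auto
  then obtain i where i: "i \<in> I" "b i > 0" using assms(2) by auto
  \<comment> \<open>The factor at \<open>x\<close> uses up one power of \<open>lin (lv i)\<close>;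
    the induction hypothesis removes the remaining ones.\<close>
  define b2 where "b2 = b(i := b i - 1)"
  have "sum b I = Suc (sum b2 I)"
    using i assms(2) by (simp add: b2_def sum.remove[of I i])
  then have "card J = sum b2 I" using insert by simp
  from insert.IH[OF this insert.prems(2)]
  obtain h c where h: "\<forall>j\<in>J. \<forall>x\<in>C j. dot (h j) x = 0" and c: "c \<noteq> 0"
    and eq: "act (\<Prod>j\<in>J. lin (h j)) (\<Prod>i\<in>I. lin (lv i) ^ (b2 i + b' i)) =
      Const c * (\<Prod>i\<in>I. lin (lv i) ^ b' i)" by auto
  obtain g where g: "\<And>y. y \<in> C x \<union> lv ` (I - {i}) \<Longrightarrow> dot g y = 0" "dot g (lv i) = 1"
    using separating_functional[OF insert.prems(2)[of x i]] i by auto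
  have upd: "(\<lambda>j. b j + b' j)(i := b i + b' i - 1) = (\<lambda>j. b2 j + b' j)"
    using i by (auto simp: b2_def)
  have "act (lin g) (\<Prod>i\<in>I. lin (lv i) ^ (b i + b' i)) =
      Const (of_nat (b i + b' i)) * (\<Prod>i\<in>I. lin (lv i) ^ (b2 i + b' i))"
    using act_lin_monomial[OF assms(2) i(1), of "\<lambda>j. b j + b' j" g lv] i(2) g
    unfolding upd by auto
  then have "act (\<Prod>j\<in>J. lin (h j)) (act (lin g) (\<Prod>i\<in>I. lin (lv i) ^ (b i + b' i))) =
      Const (of_nat (b i + b' i) * c) * (\<Prod>i\<in>I. lin (lv i) ^ b' i)"
    by (simp add: act_smult eq Const_mult mult.assoc)
  moreover have "(\<Prod>j\<in>J. lin ((h(x := g)) j)) = (\<Prod>j\<in>J. lin (h j))"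
    using insert.hyps by (intro prod.cong) auto
  ultimately have "act (\<Prod>j\<in>insert x J. lin ((h(x := g)) j)) (\<Prod>i\<in>I. lin (lv i) ^ (b i + b' i)) =
      Const (of_nat (b i + b' i) * c) * (\<Prod>i\<in>I. lin (lv i) ^ b' i)"
    using insert.hyps by (simp add: act_mult act_commute[of "lin g"])
  \<comment> \<open>Characteristic 0 enters here.\<close>
  moreover have "of_nat (b i + b' i) * c \<noteq> 0" using i c by (simp del: of_nat_add)
  moreover have "\<forall>j\<in>insert x J. \<forall>y\<in>C j. dot ((h(x := g)) j) y = 0"
    using h g insert.hyps by auto
  ultimately show ?case by blast
qed

section \<open>Representatives of projective points\<close>

text \<open>A chosen vector for each point moves the argument to linear algebra. The choice matters
  only up to a nonzero scalar, to which spans and zeros of functionals are insensitive.\<close>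

definition repr :: "('v::finite, 'a::field) pt \<Rightarrow> 'a ^ 'v" where
  "repr p = (SOME v. v \<noteq> 0 \<and> p = proj_point v)"

lemma repr:
  assumes "p \<in> proj_space"
  shows "repr p \<noteq> 0" "proj_point (repr p) = p"
proof -
  obtain v where "v \<noteq> 0 \<and> p = proj_point v"
    using assms by (auto simp: proj_space_def)
  then have *: "repr p \<noteq> 0 \<and> p = proj_point (repr p)"
    unfolding repr_def by (rule someI[of "\<lambda>v. v \<noteq> 0 \<and> p = proj_point v"])
  show "repr p \<noteq> 0" by (rule conjunct1[OF *])
  show "proj_point (repr p) = p" by (rule conjunct2[OF *, symmetric])
qed

lemma proj_point_in_proj_space: "v \<noteq> 0 \<Longrightarrow> proj_point v \<in> proj_space"
  by (auto simp: proj_space_def)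

lemma proj_point_subset_iff: "proj_point v \<subseteq> vec.span X \<longleftrightarrow> v \<in> vec.span X"
  unfolding proj_point_def
  by (meson empty_subsetI insert_subset subset_trans vec.span_minimal vec.span_superset vec.subspace_span)

lemma repr_in_self: "p \<in> proj_space \<Longrightarrow> repr p \<in> p"
  using repr(2)[of p] vec.span_base[of "repr p" "{repr p}"] by (simp add: proj_point_def)

lemma subset_span_iff_repr:
  "p \<in> proj_space \<Longrightarrow> p \<subseteq> vec.span X \<longleftrightarrow> repr p \<in> vec.span X"
  using proj_point_subset_iff[of "repr p" X] repr(2) by metis

lemma inj_on_repr: "inj_on repr proj_space"
  by (metis inj_onI repr(2))

lemma dot_repr_proj_point:
  assumes "v \<noteq> 0"
  shows "dot h (repr (proj_point v)) = 0 \<longleftrightarrow> dot h v = 0"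
proof -
  have p: "proj_point v \<in> proj_space" using assms by (rule proj_point_in_proj_space)
  have "repr (proj_point v) \<in> vec.span {v}" "v \<in> vec.span {repr (proj_point v)}"
    using repr_in_self[OF p] repr(2)[OF p] vec.span_base[of v "{v}"] by (auto simp: proj_point_def)
  then show ?thesis using dot_eq_0_span by blast
qed

lemma Union_subset_span_repr:
  assumes "Y \<subseteq> proj_space" shows "\<Union>Y \<subseteq> vec.span (repr ` Y)"
proof
  fix v assume "v \<in> \<Union>Y"
  then obtain p where p: "p \<in> Y" "v \<in> p" by blast
  then have "repr p \<in> vec.span (repr ` Y)" by (intro vec.span_base) blast
  then show "v \<in> vec.span (repr ` Y)"
    using p assms subset_span_iff_repr by blast
qed

lemma span_Union_eq:
  assumes "Y \<subseteq> proj_space" shows "vec.span (\<Union>Y) = vec.span (repr ` Y)"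
proof
  show "vec.span (\<Union>Y) \<subseteq> vec.span (repr ` Y)"
    using Union_subset_span_repr[OF assms] by (intro vec.span_minimal) auto
  show "vec.span (repr ` Y) \<subseteq> vec.span (\<Union>Y)"
    using assms repr_in_self by (intro vec.span_mono) blast
qed

lemma subset_proj_span:
  assumes "X \<subseteq> proj_space" shows "X \<subseteq> proj_span X"
proof
  fix p assume p: "p \<in> X"
  then have "p \<subseteq> vec.span (\<Union>X)" using vec.span_superset[of "\<Union>X"] by blast
  then show "p \<in> proj_span X" using p assms by (auto simp: proj_span_def)
qed

section \<open>Hyperplanes and the vanishing ideal\<close>

lemma zero_locus_lin_iff:
  "p \<in> zero_locus (lin h) \<longleftrightarrow> p \<in> proj_space \<and> dot h (repr p) = 0"
proof -
  have "(\<forall>v\<in>p. dot h v = 0) \<longleftrightarrow> dot h (repr p) = 0" if p: "p \<in> proj_space"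
    using repr_in_self[OF p] subset_span_iff_repr[OF p, of "{repr p}"]
      vec.span_base[of "repr p" "{repr p}"] dot_eq_0_span by blast
  then show ?thesis by (auto simp: zero_locus_def eval_lin)
qed

lemma zero_locus_prod: "finite A \<Longrightarrow> j \<in> A \<Longrightarrow> zero_locus (f j) \<subseteq> zero_locus (prod f A)"
  by (auto simp: zero_locus_def eval_prod)

text \<open>If each point lies on one of the hyperplanes, the product vanishes on \<open>Z\<close>;
  being homogeneous, it is one of the generators. No other elements of the ideal enter the
  proof.\<close>

lemma prod_lin_in_vanishing_ideal:
  assumes "finite A" "Z \<subseteq> proj_space" "\<And>p. p \<in> Z \<Longrightarrow> \<exists>j\<in>A. dot (h j) (repr p) = 0"
  shows "(\<Prod>j\<in>A. lin (h j)) \<in> vanishing_ideal Z"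
proof -
  have "Z \<subseteq> zero_locus (\<Prod>j\<in>A. lin (h j))"
  proof
    fix p assume p: "p \<in> Z"
    then obtain j where j: "j \<in> A" "dot (h j) (repr p) = 0" using assms by blast
    then have "p \<in> zero_locus (lin (h j))" using p assms by (auto simp: zero_locus_lin_iff)
    then show "p \<in> zero_locus (\<Prod>j\<in>A. lin (h j))"
      using zero_locus_prod[OF assms(1) j(1), of "\<lambda>j. lin (h j)"] by blast
  qed
  moreover have "(\<Prod>j\<in>A. lin (h j)) \<in> forms (\<Sum>j\<in>A. 1)"
    by (intro forms_prod lin_forms)
  ultimately show ?thesis
    unfolding vanishing_ideal_def ideal_gen_def
    by (intro module.span_base[OF module_times]) blast
qed

section \<open>Splittings\<close>

text \<open>The assumption that \<open>L\<close> has dimension \<open>k\<close> takes the form of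
  independence of the \<open>k + 1\<close> vectors \<open>lv i\<close>. Independence concerns a set,
  so injectivity is stated separately.\<close>

locale linear_factors =
  fixes lv :: "nat \<Rightarrow> 'a::field_char_0 ^ 'v::finite" and a :: "nat \<Rightarrow> nat" and k d :: nat
    and L :: "('v, 'a) pt set"
  assumes indep: "vec.independent (lv ` {..k})"
    and inj: "inj_on lv {..k}"
    and L: "L = {p \<in> proj_space. p \<subseteq> vec.span (lv ` {..k})}"
    and d: "d = (\<Sum>i\<le>k. a i) + 2"
begin

definition M :: "('v, 'a) mpol" where
  "M = (\<Prod>i\<le>k. lin (lv i) ^ a i)"

text \<open>Combines independence of the points with a span that misses \<open>L\<close>. The union
  alone would not notice a representative that equals some \<open>lv i\<close>, hence the first
  clause.\<close>

definition transversal :: "('v, 'a) pt set \<Rightarrow> bool" where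
  "transversal Y \<longleftrightarrow>
     repr ` Y \<inter> lv ` {..k} = {} \<and> vec.independent (repr ` Y \<union> lv ` {..k})"

lemma card_lv: "card (lv ` {..k}) = Suc k"
  using inj by (simp add: card_image)

lemma lv_nonzero: "i \<le> k \<Longrightarrow> lv i \<noteq> 0"
  using indep vec.dependent_zero by (metis atMost_iff imageI)

text \<open>Thanks to this, a hyperplane through \<open>Y\<close> can be made dual to any chosen
  \<open>lv i\<close>.\<close>

lemma transversal_notin_span:
  assumes "transversal Y" "i \<le> k"
  shows "lv i \<notin> vec.span (repr ` Y \<union> lv ` ({..k} - {i}))"
proof -
  have "(repr ` Y \<union> lv ` {..k}) - {lv i} = repr ` Y \<union> lv ` ({..k} - {i})"
    using assms inj by (auto simp: transversal_def inj_on_def)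
  moreover have "lv i \<notin> vec.span ((repr ` Y \<union> lv ` {..k}) - {lv i})"
    using assms unfolding transversal_def vec.dependent_def by blast
  ultimately show ?thesis by simp
qed

lemma transversal_empty: "transversal {}"
  using indep by (simp add: transversal_def)

text \<open>Extend the basis \<open>lv\<close> of the space of \<open>L\<close> by representatives
  of points of \<open>X\<close> to a basis of everything; the added vectors give
  \<open>Y\<close>.\<close>

lemma ex_transversal:
  assumes "X \<subseteq> proj_space" "vec.span (repr ` X \<union> lv ` {..k}) = UNIV"
  shows "\<exists>Y\<subseteq>X. transversal Y \<and> card Y = CARD('v) - Suc k"
proof -
  obtain B where B: "lv ` {..k} \<subseteq> B" "B \<subseteq> repr ` X \<union> lv ` {..k}" "vec.independent B"
      "repr ` X \<union> lv ` {..k} \<subseteq> vec.span B"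
    using vec.maximal_independent_subset_extend[OF _ indep, of "repr ` X \<union> lv ` {..k}"] by blast
  have "UNIV \<subseteq> vec.span B"
    using assms(2) B(4) vec.span_minimal[OF B(4) vec.subspace_span] by simp
  then have "card B = CARD('v)"
    using vec.basis_card_eq_dim[of B UNIV] B(3) vec_dim_card[where 'a = 'a and 'n = 'v] by simp
  define Y where "Y = {p \<in> X. repr p \<in> B - lv ` {..k}}"
  have Y: "repr ` Y = B - lv ` {..k}" using B(2) by (auto simp: Y_def)
  have "inj_on repr Y" by (rule inj_on_subset[OF inj_on_repr]) (use assms(1) in \<open>auto simp: Y_def\<close>)
  then have "card Y = card (B - lv ` {..k})" using Y card_image by metis
  also have "\<dots> = CARD('v) - Suc k"
    using B(1) \<open>card B = CARD('v)\<close> card_lv by (simp add: card_Diff_subset)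
  finally have "card Y = CARD('v) - Suc k" .
  moreover have "B - lv ` {..k} \<union> lv ` {..k} = B" using B(1) by blast
  then have "transversal Y" using B(3) by (auto simp: transversal_def Y)
  moreover have "Y \<subseteq> X" by (auto simp: Y_def)
  ultimately show ?thesis by blast
qed

text \<open>A nonzero common vector is the same as a common point.\<close>

lemma proj_span_Int_L:
  assumes "Y \<subseteq> proj_space"
  shows "proj_span Y \<inter> L = {} \<longleftrightarrow>
    (\<forall>v. v \<in> vec.span (repr ` Y) \<longrightarrow> v \<in> vec.span (lv ` {..k}) \<longrightarrow> v = 0)"
proof
  assume *: "proj_span Y \<inter> L = {}"
  show "\<forall>v. v \<in> vec.span (repr ` Y) \<longrightarrow> v \<in> vec.span (lv ` {..k}) \<longrightarrow> v = 0"
  proof (intro allI impI, rule ccontr)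
    fix v assume "v \<in> vec.span (repr ` Y)" "v \<in> vec.span (lv ` {..k})" "v \<noteq> 0"
    then have "proj_point v \<in> proj_span Y \<inter> L"
      by (simp add: L proj_span_def span_Union_eq[OF assms] proj_point_subset_iff
          proj_point_in_proj_space)
    with * show False by blast
  qed
next
  assume *: "\<forall>v. v \<in> vec.span (repr ` Y) \<longrightarrow> v \<in> vec.span (lv ` {..k}) \<longrightarrow> v = 0"
  show "proj_span Y \<inter> L = {}"
  proof (rule ccontr)
    assume "proj_span Y \<inter> L \<noteq> {}"
    then obtain p where "p \<in> proj_space" "p \<subseteq> vec.span (repr ` Y)" "p \<subseteq> vec.span (lv ` {..k})"
      by (auto simp: L proj_span_def span_Union_eq[OF assms])
    then show False using * subset_span_iff_repr repr(1) by blast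
  qed
qed

lemma transversal_imp:
  assumes "transversal Y" "Y \<subseteq> proj_space"
  shows "indep_points Y" "proj_span Y \<inter> L = {}"
proof -
  have "vec.independent (repr ` Y)"
    using assms(1) vec.independent_mono unfolding transversal_def by blast
  then show "indep_points Y"
    unfolding indep_points_def using repr assms(2) by (intro exI[of _ repr]) auto
  show "proj_span Y \<inter> L = {}"
    using assms(1) span_disjoint_independent unfolding proj_span_Int_L[OF assms(2)] transversal_def
    by blast
qed

text \<open>The representatives in \<open>indep_points\<close> need not be those of
  \<open>repr\<close>. But the latter span at least as much with equally many vectors, so they are
  independent too.\<close>

lemma transversal_if:
  assumes "finite Y" "Y \<subseteq> proj_space" "indep_points Y" "proj_span Y \<inter> L = {}"
  shows "transversal Y"
proof -
  obtain b where b: "\<And>p. p \<in> Y \<Longrightarrow> b p \<noteq> 0" "\<And>p. p \<in> Y \<Longrightarrow> p = proj_point (b p)"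
    and ind: "vec.independent (b ` Y)"
    using assms(3) unfolding indep_points_def by blast
  have "inj_on b Y" using b(2) by (metis inj_onI)
  have "b p \<in> vec.span (repr ` Y)" if "p \<in> Y" for p
  proof -
    have "b p \<in> p" using b(2)[OF that] vec.span_base[of "b p" "{b p}"] by (simp add: proj_point_def)
    then show ?thesis using Union_subset_span_repr[OF assms(2)] that by blast
  qed
  then have sub: "vec.span (b ` Y) \<subseteq> vec.span (repr ` Y)"
    by (intro vec.span_minimal) auto
  have "card (repr ` Y) = card (b ` Y)"
    using \<open>inj_on b Y\<close> inj_on_subset[OF inj_on_repr assms(2)] by (simp add: card_image)
  also have "\<dots> = vec.dim (vec.span (b ` Y))"
    using vec.dim_span_eq_card_independent[OF ind] by simp
  also have "\<dots> \<le> vec.dim (vec.span (repr ` Y))" by (rule vec.dim_subset[OF sub])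
  finally have Y: "vec.independent (repr ` Y)"
    using assms(1) vec.card_le_dim_spanning[OF vec.span_superset order_refl] by blast
  have disj: "v = 0" if "v \<in> vec.span (repr ` Y)" "v \<in> vec.span (lv ` {..k})" for v
    using assms(4) that unfolding proj_span_Int_L[OF assms(2)] by blast
  have "repr ` Y \<inter> lv ` {..k} = {}"
  proof (rule ccontr)
    assume "repr ` Y \<inter> lv ` {..k} \<noteq> {}"
    then obtain v where v: "v \<in> repr ` Y" "v \<in> lv ` {..k}" by blast
    then have "v = 0" by (intro disj vec.span_base)
    then show False using v(2) lv_nonzero by auto
  qed
  moreover have "vec.independent (repr ` Y \<union> lv ` {..k})"
    by (rule independent_Un_if_disjoint_spans[OF Y indep disj])
  ultimately show ?thesis unfolding transversal_def by (rule conjI)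
qed

lemma L_subset_zero_locus_iff:
  "L \<subseteq> zero_locus (lin h) \<longleftrightarrow> (\<forall>i\<le>k. dot h (lv i) = 0)"
proof
  assume *: "L \<subseteq> zero_locus (lin h)"
  show "\<forall>i\<le>k. dot h (lv i) = 0"
  proof (intro allI impI)
    fix i assume i: "i \<le> k"
    then have "proj_point (lv i) \<in> L"
      using lv_nonzero[OF i] vec.span_base[of "lv i" "lv ` {..k}"]
      by (simp add: L proj_point_in_proj_space proj_point_subset_iff)
    then show "dot h (lv i) = 0"
      using * dot_repr_proj_point[OF lv_nonzero[OF i], of h] by (auto simp: zero_locus_lin_iff)
  qed
next
  assume *: "\<forall>i\<le>k. dot h (lv i) = 0"
  show "L \<subseteq> zero_locus (lin h)"
  proof
    fix p assume "p \<in> L"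
    then have "p \<in> proj_space" "repr p \<in> vec.span (lv ` {..k})"
      using subset_span_iff_repr by (auto simp: L)
    then show "p \<in> zero_locus (lin h)"
      using dot_eq_0_span * by (auto simp: zero_locus_lin_iff)
  qed
qed

text \<open>
  If the remaining points \<open>X\<close> did not span modulo \<open>L\<close>, a hyperplane through \<open>X\<close> and \<open>L\<close> times
  hyperplanes through the sets already chosen would annihilate \<open>F\<close>. The latter hyperplanes can be
  prescribed on \<open>L\<close>, hence chosen so as not to annihilate \<open>M\<close>.
\<close>

lemma rest_spans:
  assumes F: "concise F" and cond: "ann_condition d F M L"
    and Z: "Z \<subseteq> proj_space"
    and ann: "\<And>h e. e \<in> {1..d - 1} \<Longrightarrow> (\<forall>p\<in>Z. \<exists>j\<in>{1..e}. dot (h j) (repr p) = 0) \<Longrightarrow>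
      act (\<Prod>j=1..e. lin (h j)) F = 0"
    and e: "e < d - 1" and Zs: "\<And>j. j \<in> {1..e} \<Longrightarrow> transversal (Zs j)"
    and X: "X = Z - (\<Union>j\<in>{1..e}. Zs j)"
  shows "vec.span (repr ` X \<union> lv ` {..k}) = UNIV"
proof (rule ccontr)
  assume "\<not> ?thesis"
  then obtain w where "w \<notin> vec.span (repr ` X \<union> lv ` {..k})" by blast
  then obtain g where g: "\<And>x. x \<in> repr ` X \<union> lv ` {..k} \<Longrightarrow> dot g x = 0" "dot g w = 1"
    by (rule separating_functional) blast
  have "g \<noteq> 0" using g(2) by auto
  define C where "C j = (if j \<in> {1..e} then repr ` Zs j else {})" for j
  have C: "lv i \<notin> vec.span (C j \<union> lv ` ({..k} - {i}))" if "i \<in> {..k}" for i j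
    using transversal_notin_span[OF Zs, of j i] transversal_notin_span[OF transversal_empty, of i] that
    by (simp add: C_def)
  \<comment> \<open>As \<open>M\<close> has degree \<open>d - 2\<close>, that many factors take it
    to a nonzero constant. Those after position \<open>e\<close> only witness that the first
    \<open>e\<close> do not annihilate \<open>M\<close>.\<close>
  obtain h c where h: "\<forall>j\<in>{1..d - 2}. \<forall>x\<in>C j. dot (h j) x = 0" and "c \<noteq> 0"
    and act: "act (\<Prod>j\<in>{1..d - 2}. lin (h j)) (\<Prod>i\<in>{..k}. lin (lv i) ^ (a i + 0)) =
      Const c * (\<Prod>i\<in>{..k}. lin (lv i) ^ 0)"
    using ex_lin_product_reducing_monomial[of "{1..d - 2}" "{..k}" a lv C "\<lambda>_. 0"] C d by auto
  have "(\<Prod>j\<in>{1..d - 2}. lin (h j)) = (\<Prod>j\<in>{e + 1..d - 2}. lin (h j)) * (\<Prod>j\<in>{1..e}. lin (h j))"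
  proof -
    have "{1..d - 2} = {e + 1..d - 2} \<union> {1..e}" using e by auto
    then show ?thesis by (simp add: prod.union_disjoint)
  qed
  then have nz: "act (\<Prod>j=1..e. lin (h j)) M \<noteq> 0"
    using act \<open>c \<noteq> 0\<close> by (auto simp: act_mult M_def)
  \<comment> \<open>The hyperplane containing \<open>L\<close> takes the last position, as in
    \<open>ann_condition\<close>.\<close>
  define h' where "h' = h(e + 1 := g)"
  have prod: "(\<Prod>j=1..e. lin (h' j)) = (\<Prod>j=1..e. lin (h j))"
    by (intro prod.cong) (auto simp: h'_def)
  have "\<exists>j\<in>{1..e + 1}. dot (h' j) (repr p) = 0" if p: "p \<in> Z" for p
  proof (cases "p \<in> X")
    case True
    then show ?thesis using g by (intro bexI[of _ "e + 1"]) (auto simp: h'_def)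
  next
    case False
    then obtain j where j: "j \<in> {1..e}" "p \<in> Zs j" using p X by auto
    then have "dot (h j) (repr p) = 0" using h e by (auto simp: C_def)
    then show ?thesis using j by (intro bexI[of _ j]) (auto simp: h'_def)
  qed
  then have annF: "act (\<Prod>j=1..e + 1. lin (h' j)) F = 0"
    using e by (intro ann) auto
  \<comment> \<open>\<open>ann_condition\<close> starts at two factors, so a single one is left to
    conciseness.\<close>
  show False
  proof (cases "e = 0")
    case True
    then have "lin g \<in> Ann F \<inter> forms 1" using annF lin_forms[of g] by (auto simp: Ann_def h'_def)
    then have "lin g = 0" using F by (simp only: concise_def) blast
    then show False using \<open>g \<noteq> 0\<close> by simp
  next
    case False
    have "h' j \<noteq> 0" if "j \<in> {1..e + 1}" for j
    proof
      assume "h' j = 0"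
      then have "j \<in> {1..e}" "lin (h j) = 0" using that \<open>g \<noteq> 0\<close> by (auto simp: h'_def split: if_splits)
      then have "(\<Prod>j=1..e. lin (h j)) = 0" by (intro prod_zero) auto
      then show False using nz by simp
    qed
    moreover have "L \<subseteq> zero_locus (lin (h' (e + 1)))"
      using g by (auto simp: L_subset_zero_locus_iff h'_def)
    ultimately have "act (\<Prod>j=1..(e + 1) - 1. lin (h' j)) M = 0"
      using cond[unfolded ann_condition_def, rule_format, of "e + 1" "\<lambda>j. lin (h' j)"]
        annF e False lin_forms by (auto simp: Ann_def)
    then show False using nz prod by simp
  qed
qed

text \<open>Greedy choice: the points not yet used still span modulo \<open>L\<close>, so they
  contain a further transversal set.\<close>

lemma ex_disjoint_transversals:
  assumes F: "concise F" and cond: "ann_condition d F M L"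
    and Z: "Z \<subseteq> proj_space"
    and ann: "\<And>h e. e \<in> {1..d - 1} \<Longrightarrow> (\<forall>p\<in>Z. \<exists>j\<in>{1..e}. dot (h j) (repr p) = 0) \<Longrightarrow>
      act (\<Prod>j=1..e. lin (h j)) F = 0"
    and "e \<le> d - 1"
  shows "\<exists>Zs. disjoint_family_on Zs {1..e} \<and>
    (\<forall>j\<in>{1..e}. Zs j \<subseteq> Z \<and> transversal (Zs j) \<and> card (Zs j) = CARD('v) - Suc k)"
  using assms(5)
proof (induction e)
  case 0
  show ?case by (auto simp: disjoint_family_on_def)
next
  case (Suc e)
  then obtain Zs where Zs: "disjoint_family_on Zs {1..e}"
    "\<And>j. j \<in> {1..e} \<Longrightarrow> Zs j \<subseteq> Z \<and> transversal (Zs j) \<and> card (Zs j) = CARD('v) - Suc k" by auto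
  define X where "X = Z - (\<Union>j\<in>{1..e}. Zs j)"
  have "vec.span (repr ` X \<union> lv ` {..k}) = UNIV"
    using rest_spans[OF F cond Z ann _ _ X_def] Suc.prems Zs(2) by auto
  then obtain Y where Y: "Y \<subseteq> X" "transversal Y" "card Y = CARD('v) - Suc k"
    using ex_transversal[of X] Z by (auto simp: X_def)
  let ?Zs = "\<lambda>i. if i = Suc e then Y else Zs i"
  have "?Zs i \<inter> ?Zs j = {}" if ij: "i \<in> {1..Suc e}" "j \<in> {1..Suc e}" "i \<noteq> j" for i j
  proof -
    have YZ: "Y \<inter> Zs i = {}" if "i \<in> {1..e}" for i using Y(1) that unfolding X_def by blast
    consider "i = Suc e" "j \<in> {1..e}" | "j = Suc e" "i \<in> {1..e}" | "i \<in> {1..e}" "j \<in> {1..e}"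
      using ij by fastforce
    then show ?thesis
    proof cases
      case 1 then show ?thesis using YZ[of j] by simp
    next
      case 2 then show ?thesis using YZ[of i] by (simp add: Int_commute)
    next
      case 3 then show ?thesis using Zs(1) ij(3) by (simp add: disjoint_family_on_def)
    qed
  qed
  then have "disjoint_family_on ?Zs {1..Suc e}" by (simp only: disjoint_family_on_def) blast
  moreover have "?Zs i \<subseteq> Z \<and> transversal (?Zs i) \<and> card (?Zs i) = CARD('v) - Suc k"
    if "i \<in> {1..Suc e}" for i
  proof (cases "i = Suc e")
    case True
    then show ?thesis using Y by (simp add: X_def subset_iff)
  next
    case False
    then have "i \<in> {1..e}" using that by auto
    then show ?thesis using Zs(2)[of i] False by simp
  qed
  ultimately show ?case by (intro exI[of _ ?Zs] conjI[OF _ ballI])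
qed

text \<open>The last set collects all points left over. The hypothesis on products of degree below
  \<open>d\<close> stands in for \<open>vanishing_ideal Z \<subseteq> Ann F\<close>, because it is
  also available for the points of a decomposition counted by \<open>psrk\<close>.\<close>

lemma ex_splitting:
  assumes F: "concise F" and cond: "ann_condition d F M L"
    and Z: "Z \<subseteq> proj_space"
    and ann: "\<And>h e. e \<in> {1..d - 1} \<Longrightarrow> (\<forall>p\<in>Z. \<exists>j\<in>{1..e}. dot (h j) (repr p) = 0) \<Longrightarrow>
      act (\<Prod>j=1..e. lin (h j)) F = 0"
  shows "\<exists>Zs. splitting d (CARD('v) - Suc k) L Z Zs \<and> disjoint_family_on Zs {1..d}"
proof -
  obtain Zs where Zs: "disjoint_family_on Zs {1..d - 1}"
    "\<And>j. j \<in> {1..d - 1} \<Longrightarrow> Zs j \<subseteq> Z \<and> transversal (Zs j) \<and> card (Zs j) = CARD('v) - Suc k"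
    using ex_disjoint_transversals[OF F cond Z ann, of "d - 1"] by auto
  define W where "W = Z - (\<Union>j\<in>{1..d - 1}. Zs j)"
  have eq: "{1..d} = insert d {1..d - 1}" "d \<notin> {1..d - 1}" using d by auto
  have "disjoint_family_on (Zs(d := W)) {1..d}"
    using Zs(1) eq(2) unfolding disjoint_family_on_def eq(1) W_def by auto
  moreover have "Z = (\<Union>i\<in>{1..d}. (Zs(d := W)) i)"
  proof -
    have "(\<Union>i\<in>{1..d - 1}. Zs i) \<subseteq> Z" using Zs(2) by blast
    moreover have "(\<Union>i\<in>{1..d - 1}. (Zs(d := W)) i) = (\<Union>i\<in>{1..d - 1}. Zs i)"
      using eq(2) by (intro SUP_cong refl) auto
    ultimately show ?thesis unfolding eq(1) W_def by auto
  qed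
  moreover have "card ((Zs(d := W)) i) = CARD('v) - Suc k \<and> indep_points ((Zs(d := W)) i) \<and>
      proj_span ((Zs(d := W)) i) \<inter> L = {}" if "i \<in> {1..d - 1}" for i
    using that Zs(2)[OF that] transversal_imp[of "Zs i"] Z eq(2) by auto
  ultimately show ?thesis unfolding splitting_def by blast
qed

text \<open>Disjointness lets the sizes of the first \<open>d - 1\<close> sets add up; nothing is
  known about the last one.\<close>

lemma card_ge_if_splitting:
  assumes "finite Z" "splitting d m L Z Zs" "disjoint_family_on Zs {1..d}"
  shows "(d - 1) * m \<le> card Z"
proof -
  have sub: "{1..d - 1} \<subseteq> {1..d}" by auto
  have fin: "finite (Zs i)" if "i \<in> {1..d - 1}" for i
    using assms(1,2) that d unfolding splitting_def
    by (metis (no_types, lifting) UN_upper atLeastAtMost_iff diff_le_self finite_subset le_trans)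
  have "(d - 1) * m = (\<Sum>i\<in>{1..d - 1}. card (Zs i))"
    using assms(2) by (simp add: splitting_def)
  also have "\<dots> = card (\<Union>i\<in>{1..d - 1}. Zs i)"
    using disjoint_family_on_mono[OF sub assms(3)] fin
    by (subst card_UN_disjoint) (auto simp: disjoint_family_on_def)
  also have "\<dots> \<le> card Z"
    using sub assms(2) unfolding splitting_def by (intro card_mono[OF assms(1)]) blast
  finally show ?thesis .
qed

text \<open>
  A point \<open>z\<close> of \<open>Zs 1\<close> is covered together with \<open>Zs 2\<close>. This leaves room for the hyperplane
  through \<open>L\<close> and the rest of \<open>Zs 1\<close>, whose action on \<open>M * lin p\<close> leaves only \<open>M\<close>.
\<close>

lemma ex_lin_product_nonzero:
  assumes k: "0 < k" and a: "\<And>i. i \<le> k \<Longrightarrow> 0 < a i"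
    and Zs: "\<And>i. i \<in> {1..d - 1} \<Longrightarrow> transversal (Zs i) \<and> Zs i \<subseteq> proj_space \<and>
      finite (Zs i) \<and> card (Zs i) = CARD('v) - Suc k"
    and p: "p \<notin> vec.span (lv ` {..k})"
  shows "\<exists>h. (\<forall>i\<in>{1..d - 1}. \<forall>z\<in>Zs i. \<exists>j\<in>{1..d - 1}. dot (h j) (repr z) = 0) \<and>
    act (\<Prod>j=1..d - 1. lin (h j)) (M * lin p) \<noteq> 0"
proof -
  let ?Lv = "lv ` {..k}"
  \<comment> \<open>Two factors of \<open>M\<close> force \<open>d \<ge> 4\<close>, so positions 1
    and 2 exist, and the \<open>d - 3\<close> positions from 3 on are one fewer than the degree of
    \<open>M\<close>.\<close>
  have "a 0 + a 1 \<le> (\<Sum>i\<le>k. a i)"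
    using sum_mono2[of "{..k}" "{0, 1}" a] k by auto
  then have d4: "4 \<le> d" using a[of 0] a[of 1] k d by auto
  have span1: "vec.span (repr ` Zs 1 \<union> ?Lv) = UNIV"
  proof -
    have Z1: "transversal (Zs 1)" "Zs 1 \<subseteq> proj_space" "finite (Zs 1)" "card (Zs 1) = CARD('v) - Suc k"
      using Zs[of 1] d4 by auto
    have "card (repr ` Zs 1 \<union> ?Lv) = card (repr ` Zs 1) + card ?Lv"
      using Z1 by (intro card_Un_disjoint) (auto simp: transversal_def)
    also have "\<dots> = CARD('v) - Suc k + Suc k"
      using Z1 inj_on_subset[OF inj_on_repr Z1(2)] card_lv by (simp add: card_image)
    finally have "CARD('v) \<le> card (repr ` Zs 1 \<union> ?Lv)" by simp
    then have "UNIV \<subseteq> vec.span (repr ` Zs 1 \<union> ?Lv)"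
      using Z1(1) unfolding transversal_def
      by (intro vec.card_ge_dim_independent) (auto simp: vec_dim_card simp del: vec.dim_UNIV)
    then show ?thesis by blast
  qed
  have "p \<notin> vec.span ((repr ` Zs 1 \<union> ?Lv) - repr ` Zs 1)"
  proof -
    have "(repr ` Zs 1 \<union> ?Lv) - repr ` Zs 1 \<subseteq> ?Lv" by blast
    then show ?thesis using p vec.span_mono by blast
  qed
  \<comment> \<open>A point of \<open>Zs 1\<close> at which \<open>p\<close> has a nonzero
    coordinate.\<close>
  then obtain z where z: "z \<in> Zs 1" "p \<notin> vec.span ((repr ` Zs 1 \<union> ?Lv) - {repr z})"
    using notin_span_delete[of "repr ` Zs 1 \<union> ?Lv" p "repr ` Zs 1"] span1 Zs[of 1] d4
    by (auto simp: transversal_def)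
  obtain h1 where h1: "\<And>x. x \<in> (repr ` Zs 1 \<union> ?Lv) - {repr z} \<Longrightarrow> dot h1 x = 0" "dot h1 p = 1"
    using separating_functional[OF z(2)] by blast
  have h1_lv: "dot h1 (lv i) = 0" if "i \<le> k" for i
  proof -
    have "lv i \<noteq> repr z" using that z(1) Zs[of 1] d4 unfolding transversal_def by fastforce
    then show ?thesis using h1(1)[of "lv i"] that by simp
  qed
  \<comment> \<open>Otherwise one further vector \<open>repr z\<close> would make the span of
    \<open>Zs 2\<close> contain all \<open>k + 1\<close> vectors \<open>lv i\<close>, which are
    independent modulo \<open>Zs 2\<close>; this contradicts \<open>0 < k\<close>.\<close>
  obtain i0 where i0: "i0 \<le> k" "lv i0 \<notin> vec.span (insert (repr z) (repr ` Zs 2))"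
  proof (rule ccontr)
    assume "\<not> thesis"
    then have *: "?Lv \<subseteq> vec.span (insert (repr z) (repr ` Zs 2))" using that by blast
    have Z2: "transversal (Zs 2)" "Zs 2 \<subseteq> proj_space" "finite (Zs 2)" "card (Zs 2) = CARD('v) - Suc k"
      using Zs[of 2] d4 by auto
    have "repr ` Zs 2 \<union> ?Lv \<subseteq> vec.span (insert (repr z) (repr ` Zs 2))"
      using * vec.span_superset[of "insert (repr z) (repr ` Zs 2)"] by blast
    then have "card (repr ` Zs 2 \<union> ?Lv) \<le> card (insert (repr z) (repr ` Zs 2))"
      using vec.independent_span_bound[of "insert (repr z) (repr ` Zs 2)" "repr ` Zs 2 \<union> ?Lv"] Z2
      by (auto simp: transversal_def)
    moreover have "card (repr ` Zs 2 \<union> ?Lv) = card (repr ` Zs 2) + Suc k"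
      using Z2 card_lv by (subst card_Un_disjoint) (auto simp: transversal_def)
    moreover have "card (insert (repr z) (repr ` Zs 2)) \<le> Suc (card (repr ` Zs 2))"
      by (rule card_insert_le_m1) auto
    ultimately show False using k by simp
  qed
  obtain h2 where h2: "\<And>x. x \<in> insert (repr z) (repr ` Zs 2) \<Longrightarrow> dot h2 x = 0" "dot h2 (lv i0) = 1"
    using separating_functional[OF i0(2)] by blast
  \<comment> \<open>\<open>b\<close> is the part of the exponents to be removed, and
    \<open>b'\<close> keeps a single \<open>lin (lv i0)\<close> for \<open>h2\<close>.\<close>
  define b where "b i = (if i = i0 then a i - 1 else a i)" for i
  define b' :: "nat \<Rightarrow> nat" where "b' i = (if i = i0 then 1 else 0)" for i
  have ab: "b i + b' i = a i" if "i \<le> k" for i using a[OF that] by (auto simp: b_def b'_def)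
  have "(\<Sum>i\<le>k. a i) = (\<Sum>i\<le>k. b i) + (\<Sum>i\<le>k. b' i)"
    unfolding sum.distrib[symmetric] using ab by (intro sum.cong) auto
  moreover have "(\<Sum>i\<le>k. b' i) = 1" using i0(1) by (simp add: b'_def)
  ultimately have "card {3..d - 1} = sum b {..k}" using d by simp
  moreover have "lv i \<notin> vec.span (repr ` Zs j \<union> lv ` ({..k} - {i}))"
    if "j \<in> {3..d - 1}" "i \<in> {..k}" for i j
    using transversal_notin_span[of "Zs j" i] Zs[of j] that by auto
  ultimately obtain h c where h: "\<forall>j\<in>{3..d - 1}. \<forall>x\<in>repr ` Zs j. dot (h j) x = 0" and c: "c \<noteq> 0"
    and act: "act (\<Prod>j\<in>{3..d - 1}. lin (h j)) (\<Prod>i\<in>{..k}. lin (lv i) ^ (b i + b' i)) =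
      Const c * (\<Prod>i\<in>{..k}. lin (lv i) ^ b' i)"
    using ex_lin_product_reducing_monomial[of "{3..d - 1}" "{..k}" b lv "\<lambda>j. repr ` Zs j" b'] by auto
  have "(\<Prod>i\<in>{..k}. lin (lv i) ^ (b i + b' i)) = M"
    unfolding M_def using ab by (intro prod.cong) auto
  moreover have "(\<Prod>i\<in>{..k}. lin (lv i) ^ b' i) = lin (lv i0)"
  proof -
    have "(\<Prod>i\<in>{..k}. lin (lv i) ^ b' i) = (\<Prod>i\<in>{..k}. if i = i0 then lin (lv i0) else 1)"
      by (intro prod.cong) (auto simp: b'_def)
    then show ?thesis using i0(1) by simp
  qed
  ultimately have actM: "act (\<Prod>j\<in>{3..d - 1}. lin (h j)) M = Const c * lin (lv i0)"
    using act by simp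
  define g where "g = h(1 := h1, 2 := h2)"
  \<comment> \<open>Acting from the right, \<open>h1\<close> turns \<open>M * lin p\<close> into
    \<open>M\<close>, the middle factors leave a multiple of \<open>lin (lv i0)\<close>, and
    \<open>h2\<close> makes it a nonzero constant.\<close>
  have "(\<Prod>j=1..d - 1. lin (g j)) = lin h2 * ((\<Prod>j\<in>{3..d - 1}. lin (h j)) * lin h1)"
  proof -
    have "{1..d - 1} = insert 1 (insert 2 {3..d - 1})" using d4 by auto
    moreover have "(\<Prod>j\<in>{3..d - 1}. lin (g j)) = (\<Prod>j\<in>{3..d - 1}. lin (h j))"
      by (intro prod.cong) (auto simp: g_def)
    ultimately show ?thesis by (simp add: g_def mult_ac)
  qed
  moreover have "act (lin h1) (M * lin p) = M"
  proof -
    have "act (lin h1) M = 0"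
      unfolding M_def by (intro act_lin_prod_0 act_lin_power_0) (simp add: act_lin_lin h1_lv)
    then show ?thesis by (simp add: act_lin_mult act_lin_lin h1)
  qed
  ultimately have "act (\<Prod>j=1..d - 1. lin (g j)) (M * lin p) = Const c"
    by (simp only: act_mult actM act_smult act_lin_lin h2 Const_one mult_1_right)
  moreover have "\<exists>j\<in>{1..d - 1}. dot (g j) (repr x) = 0" if i: "i \<in> {1..d - 1}" "x \<in> Zs i" for i x
  proof -
    \<comment> \<open>\<open>h1\<close> does not vanish on \<open>z\<close>, but \<open>h2\<close>
      does.\<close>
    consider "x = z" | "i = 1" "x \<noteq> z" | "i = 2" | "i \<in> {3..d - 1}" using i by fastforce
    then show ?thesis
    proof cases
      case 1
      then show ?thesis using h2(1) d4 by (intro bexI[of _ 2]) (auto simp: g_def)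
    next
      case 2
      then have "repr x \<noteq> repr z"
        using i z(1) Zs[of 1] inj_on_repr d4 by (auto simp: inj_on_def subset_iff)
      then show ?thesis using 2 i h1(1) d4 by (intro bexI[of _ 1]) (auto simp: g_def)
    next
      case 3
      then show ?thesis using i h2(1) d4 by (intro bexI[of _ 2]) (auto simp: g_def)
    next
      case 4
      then show ?thesis using i h by (intro bexI[of _ i]) (auto simp: g_def)
    qed
  qed
  ultimately show ?thesis using c by (intro exI[of _ g]) auto
qed

end

section \<open>Powers of linear forms\<close>

text \<open>The factors commute, so the one with \<open>dot (h j) w = 0\<close> may act first, and a
  derivation that kills \<open>lin w\<close> kills its positive powers and 1.\<close>

lemma act_prod_lin_power:
  assumes "finite A" "j \<in> A" "dot (h j) w = 0"
  shows "act (\<Prod>j\<in>A. lin (h j)) (lin w ^ e) = 0"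
proof -
  have "(\<Prod>j\<in>A. lin (h j)) = (\<Prod>j\<in>A - {j}. lin (h j)) * lin (h j)"
    using assms by (simp add: prod.remove mult.commute)
  then show ?thesis
    using act_lin_power_0[of "h j" "lin w" e] assms(3) by (simp add: act_mult act_lin_lin)
qed

lemma act_poly_span_0:
  assumes "F \<in> poly_span X" "\<And>x. x \<in> X \<Longrightarrow> act \<delta> x = 0"
  shows "act \<delta> F = 0"
proof -
  interpret m: module "\<lambda>c (f :: ('a, 'b) mpol). Const c * f" by (rule module_Const)
  show ?thesis
    using assms(1)[unfolded poly_span_def]
    by (induction rule: m.span_induct_alt) (auto simp: act_add_right act_smult assms(2))
qed

section \<open>Points dual to a power sum decomposition\<close>

text \<open>Zero forms have no dual point and proportional forms share one, so there may be fewer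
  than \<open>r\<close> points.\<close>

definition dual_points :: "nat \<Rightarrow> (nat \<Rightarrow> ('v::finite, 'a::field) mpol) \<Rightarrow> ('v, 'a) pt set" where
  "dual_points r m = dual_point ` (m ` {j \<in> {1..r}. m j \<noteq> 0})"

lemma dual_point_eq: "dual_point f = proj_point (coeff_vec f)"
  by (simp add: dual_point_def coeff_vec_def)

lemma coeff_vec_eq_0_iff: "f \<in> forms 1 \<Longrightarrow> coeff_vec f = 0 \<longleftrightarrow> f = 0"
  by (metis lin_coeff_vec lin_eq_0_iff)

lemma finite_dual_points: "finite (dual_points r m)"
  by (simp add: dual_points_def)

lemma card_dual_points: "card (dual_points r m) \<le> r"
proof -
  have "card (dual_points r m) \<le> card {j \<in> {1..r}. m j \<noteq> 0}"
    unfolding dual_points_def image_image by (rule card_image_le) simp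
  also have "\<dots> \<le> card {1..r}" by (intro card_mono) auto
  finally show ?thesis by simp
qed

lemma dual_points_subset:
  assumes "\<forall>j\<in>{1..r}. m j \<in> forms 1" shows "dual_points r m \<subseteq> proj_space"
proof -
  have "dual_point (m j) \<in> proj_space" if "j \<in> {1..r}" "m j \<noteq> 0" for j
    using that assms coeff_vec_eq_0_iff[of "m j"]
    by (auto simp: dual_point_eq intro!: proj_point_in_proj_space)
  then show ?thesis by (auto simp: dual_points_def)
qed

text \<open>Every power in the span is killed by a factor through its dual point. A zero form
  contributes nothing since \<open>0 < e\<close>.\<close>

lemma act_prod_lin_dual_points:
  assumes m: "\<forall>j\<in>{1..r}. m j \<in> forms 1"
    and F: "F \<in> poly_span ((\<lambda>j. m j ^ e) ` {1..r})" "0 < e"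
    and A: "finite A" "\<forall>p\<in>dual_points r m. \<exists>j\<in>A. dot (h j) (repr p) = 0"
  shows "act (\<Prod>j\<in>A. lin (h j)) F = 0"
proof (rule act_poly_span_0[OF F(1)])
  fix x assume "x \<in> (\<lambda>j. m j ^ e) ` {1..r}"
  then obtain i where i: "i \<in> {1..r}" "x = m i ^ e" by blast
  show "act (\<Prod>j\<in>A. lin (h j)) x = 0"
  proof (cases "m i = 0")
    case True
    then show ?thesis using i F(2) by (simp add: zero_power)
  next
    case False
    let ?w = "coeff_vec (m i)"
    have w: "?w \<noteq> 0" "m i = lin ?w"
      using False m i by (auto simp: coeff_vec_eq_0_iff lin_coeff_vec)
    have "proj_point ?w \<in> dual_points r m"
      using False i by (auto simp: dual_points_def dual_point_eq)
    then obtain j where "j \<in> A" "dot (h j) (repr (proj_point ?w)) = 0" using A by blast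
    then have "j \<in> A" "dot (h j) ?w = 0" using dot_repr_proj_point[OF w(1)] by auto
    then have "act (\<Prod>j\<in>A. lin (h j)) (lin ?w ^ e) = 0" by (intro act_prod_lin_power A)
    then show ?thesis using i w(2) by simp
  qed
qed

section \<open>Splittings and rank bounds for \<open>F\<close>\<close>

theorem corollary3p6:
  fixes l :: "nat \<Rightarrow> ('v::finite, 'a::{alg_closed_field, field_char_0}) mpol"
    and q F :: "('v, 'a) mpol"
    and L :: "('v, 'a) pt set"
    and a :: "nat \<Rightarrow> nat"
    and n k d :: nat
  assumes n: "CARD('v) = n + 1"
    and l: "\<And>i. i \<le> k \<Longrightarrow> l i \<in> forms 1 \<and> l i \<noteq> 0"
    and l_distinct: "\<And>i j c. i \<le> k \<Longrightarrow> j \<le> k \<Longrightarrow> i \<noteq> j \<Longrightarrow> l i \<noteq> Const c * l j"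
    and a: "\<And>i. i \<le> k \<Longrightarrow> a i > 0"
    and q: "q \<in> forms 2"
    and F: "F = (\<Prod>i\<le>k. l i ^ a i) * q"
    and d: "d = (\<Sum>i\<le>k. a i) + 2"
    and concise: "concise F"
    and L: "L = proj_span ((\<lambda>i. dual_point (l i)) ` {..k})"
    and dim_L: "proj_dim L = int k"
    and cond: "ann_condition d F (\<Prod>i\<le>k. l i ^ a i) L"
  shows
    "((\<forall>Z. finite Z \<longrightarrow> Z \<subseteq> proj_space \<longrightarrow> vanishing_ideal Z \<subseteq> Ann F \<longrightarrow>
         (\<exists>Zs. splitting d (nat (int n - proj_dim L)) L Z Zs \<and> disjoint_family_on Zs {1..d})) \<and>
      srk d F \<ge> enat ((d - 1) * nat (int n - proj_dim L))) \<and>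
     (proj_dim L > 0 \<longrightarrow>
       (\<forall>Z Zs. finite Z \<longrightarrow> Z \<subseteq> proj_space \<longrightarrow>
         splitting d (nat (int n - proj_dim L)) L Z Zs \<longrightarrow>
         (\<exists>H. H \<in> forms 1 \<and> H \<noteq> 0 \<and>
              proj_sum (proj_span (Zs d)) L \<subseteq> zero_locus H \<and>
              dual_point (act H q) \<notin> L) \<longrightarrow>
         \<not> vanishing_ideal Z \<subseteq> Ann F)) \<and>
     psrk d F \<ge> enat ((d - 1) * nat (int n - proj_dim L))"
proof -
  define lv where "lv i = coeff_vec (l i)" for i
  have lin_lv: "lin (lv i) = l i" if "i \<le> k" for i
    using l[OF that] by (simp add: lv_def lin_coeff_vec)
  have lv0: "lv i \<noteq> 0" if "i \<le> k" for i
    using l[OF that] by (simp add: lv_def coeff_vec_eq_0_iff)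
  have dual: "dual_point (l i) = proj_point (lv i)" for i
    by (simp add: dual_point_eq lv_def)
  have "vec.span (\<Union>((\<lambda>i. dual_point (l i)) ` {..k})) = vec.span (lv ` {..k})"
  proof
    have "proj_point (lv i) \<subseteq> vec.span (lv ` {..k})" if "i \<le> k" for i
      using that by (simp add: proj_point_subset_iff vec.span_base)
    then show "vec.span (\<Union>((\<lambda>i. dual_point (l i)) ` {..k})) \<subseteq> vec.span (lv ` {..k})"
      by (intro vec.span_minimal) (auto simp: dual)
    show "vec.span (lv ` {..k}) \<subseteq> vec.span (\<Union>((\<lambda>i. dual_point (l i)) ` {..k}))"
      by (intro vec.span_mono) (auto simp: dual proj_point_def intro!: vec.span_base)
  qed
  then have L': "L = {p \<in> proj_space. p \<subseteq> vec.span (lv ` {..k})}"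
    by (simp add: L proj_span_def)
  \<comment> \<open>At most \<open>k + 1\<close> vectors span a space of dimension
    \<open>k + 1\<close>, hence they are distinct and independent.\<close>
  have "vec.dim (vec.span (lv ` {..k})) = Suc k"
  proof -
    have "vec.dim (\<Union>L) = Suc k" using dim_L by (simp add: proj_dim_def)
    moreover have "vec.dim (\<Union>L) \<le> vec.dim (vec.span (lv ` {..k}))"
      by (intro vec.dim_subset) (auto simp: L')
    moreover have "vec.dim (vec.span (lv ` {..k})) \<le> card (lv ` {..k})"
      by (intro vec.dim_le_card) auto
    moreover have "card (lv ` {..k}) \<le> Suc k"
      using card_image_le[of "{..k}" lv] by simp
    ultimately show ?thesis by simp
  qed
  moreover have "card (lv ` {..k}) \<le> Suc k" using card_image_le[of "{..k}" lv] by simp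
  ultimately have indep: "vec.independent (lv ` {..k})" and "card (lv ` {..k}) = Suc k"
    using vec.card_le_dim_spanning[of "lv ` {..k}" "vec.span (lv ` {..k})"]
      vec.dim_le_card[of "vec.span (lv ` {..k})" "lv ` {..k}"]
    by (auto simp: vec.span_superset)
  then have inj: "inj_on lv {..k}" by (intro eq_card_imp_inj_on) auto
  interpret linear_factors lv a k d L
    using indep inj L' d by unfold_locales
  have M: "M = (\<Prod>i\<le>k. l i ^ a i)"
    unfolding M_def by (intro prod.cong) (auto simp: lin_lv)
  have cond': "ann_condition d F M L" using cond by (simp only: M)
  have FM: "F = M * q" by (simp only: F M)
  have codim: "nat (int n - proj_dim L) = CARD('v) - Suc k" using n dim_L by simp
  have d3: "3 \<le> d"
    using a[of 0] member_le_sum[of 0 "{..k}" a] by (auto simp: d)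
  have "M \<in> forms (\<Sum>i\<le>k. a i * 1)"
    unfolding M_def by (intro forms_prod forms_power lin_forms)
  then have formF: "F \<in> forms d" using forms_mult[OF _ q, of M] by (simp add: FM d)

  have splitting: "\<exists>Zs. splitting d (CARD('v) - Suc k) L Z Zs \<and> disjoint_family_on Zs {1..d}"
    if "Z \<subseteq> proj_space" "vanishing_ideal Z \<subseteq> Ann F" for Z
  proof (rule ex_splitting[OF concise cond' that(1)])
    fix h :: "nat \<Rightarrow> 'a ^ 'v" and e :: nat assume "\<forall>p\<in>Z. \<exists>j\<in>{1..e}. dot (h j) (repr p) = 0"
    then have "(\<Prod>j=1..e. lin (h j)) \<in> vanishing_ideal Z"
      using that(1) by (intro prod_lin_in_vanishing_ideal) auto
    then show "act (\<Prod>j=1..e. lin (h j)) F = 0" using that(2) by (auto simp: Ann_def)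
  qed

  \<comment> \<open>Shared by both ranks: the points dual to the \<open>m j\<close> admit a disjoint
    splitting, and there are at most \<open>r\<close> of them.\<close>
  have rank_bound: "(d - 1) * (CARD('v) - Suc k) \<le> r"
    if m: "\<forall>j\<in>{1..r}. m j \<in> forms 1"
      and ann: "\<And>h e. e \<in> {1..d - 1} \<Longrightarrow>
        \<forall>p\<in>dual_points r m. \<exists>j\<in>{1..e}. dot (h j) (repr p) = 0 \<Longrightarrow>
        act (\<Prod>j=1..e. lin (h j)) F = 0" for r m
    using ex_splitting[OF concise cond' dual_points_subset[OF m] ann]
      card_ge_if_splitting[OF finite_dual_points] card_dual_points[of r m] by (meson le_trans)

  have srk: "enat ((d - 1) * (CARD('v) - Suc k)) \<le> srk d F"
    unfolding srk_def
  proof (rule Inf_greatest)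
    fix x assume "x \<in> {enat r | r. \<exists>m. (\<forall>j\<in>{1..r}. m j \<in> forms 1) \<and>
     F \<in> poly_span ((\<lambda>j. m j ^ d) ` {1..r})}"
    then obtain r m where r: "x = enat r" and m: "\<forall>j\<in>{1..r}. m j \<in> forms 1"
      and span: "F \<in> poly_span ((\<lambda>j. m j ^ d) ` {1..r})" by blast
    have "act (\<Prod>j=1..e. lin (h j)) F = 0"
      if "\<forall>p\<in>dual_points r m. \<exists>j\<in>{1..e}. dot (h j) (repr p) = 0"
      for h :: "nat \<Rightarrow> 'a ^ 'v" and e :: nat
      using act_prod_lin_dual_points[OF m span _ _ that] d3 by auto
    then show "enat ((d - 1) * (CARD('v) - Suc k)) \<le> x"
      using rank_bound[OF m] r by (simp only: enat_ord_simps)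
  qed

  have psrk: "enat ((d - 1) * (CARD('v) - Suc k)) \<le> psrk d F"
    unfolding psrk_def
  proof (rule Inf_greatest)
    fix x assume "x \<in> {enat r | r. \<exists>m. (\<forall>j\<in>{1..r}. m j \<in> forms 1) \<and>
     (\<forall>i. act (Var i) F \<in> poly_span ((\<lambda>j. m j ^ (d - 1)) ` {1..r}))}"
    then obtain r m where r: "x = enat r" and m: "\<forall>j\<in>{1..r}. m j \<in> forms 1"
      and span: "\<And>i. act (Var i) F \<in> poly_span ((\<lambda>j. m j ^ (d - 1)) ` {1..r})" by blast
    have "act (\<Prod>j=1..e. lin (h j)) F = 0"
      if e: "e \<in> {1..d - 1}"
        and h: "\<forall>p\<in>dual_points r m. \<exists>j\<in>{1..e}. dot (h j) (repr p) = 0"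
      for h :: "nat \<Rightarrow> 'a ^ 'v" and e :: nat
    \<comment> \<open>The product commutes with \<open>Var i\<close> and annihilates the partial
      derivatives of \<open>F\<close>, so the result has zero partial derivatives;
      \<open>e \<le> d - 1\<close> keeps its degree positive.\<close>
    proof (rule eq_0_if_partials_0)
      show "act (\<Prod>j=1..e. lin (h j)) F \<in> forms (d - e)"
        using forms_act_prod_lin[OF _ formF, of "{1..e}" h] by simp
      show "0 < d - e" using e d3 by auto
      show "partial i (act (\<Prod>j=1..e. lin (h j)) F) = 0" for i
        using act_prod_lin_dual_points[OF m span _ _ h] d3
          act_commute[of "Var i" "\<Prod>j=1..e. lin (h j)" F] by (simp add: act_Var)
    qed
    then show "enat ((d - 1) * (CARD('v) - Suc k)) \<le> x"
      using rank_bound[OF m] r by (simp only: enat_ord_simps)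
  qed

  have not_ann: "\<not> vanishing_ideal Z \<subseteq> Ann F"
    if k: "0 < k" and Z: "finite Z" "Z \<subseteq> proj_space"
      and Zs: "splitting d (CARD('v) - Suc k) L Z Zs"
      and H: "H \<in> forms 1" "H \<noteq> 0" "proj_sum (proj_span (Zs d)) L \<subseteq> zero_locus H"
        "dual_point (act H q) \<notin> L" for Z Zs H
  proof
    assume ann: "vanishing_ideal Z \<subseteq> Ann F"
    define g where "g = coeff_vec H"
    have g: "lin g = H" using H(1) by (simp add: g_def lin_coeff_vec)
    define p where "p = coeff_vec (act H q)"
    have "act H q \<in> forms (2 - 1)" unfolding g[symmetric] by (rule forms_act_lin[OF q])
    then have p: "act H q = lin p" by (simp add: p_def lin_coeff_vec)
    have sub: "Zs i \<subseteq> Z" if "i \<in> {1..d}" for i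
      using Zs that unfolding splitting_def by blast
    have L_sub: "L \<subseteq> zero_locus H" and Zd_sub: "Zs d \<subseteq> zero_locus H"
    proof -
      have Zd: "Zs d \<subseteq> proj_span (Zs d)"
        using sub[of d] Z(2) d3 by (intro subset_proj_span) auto
      have "proj_span (Zs d) \<union> L \<subseteq> proj_sum (proj_span (Zs d)) L"
        unfolding proj_sum_def by (intro subset_proj_span) (auto simp: L' proj_span_def)
      then show "L \<subseteq> zero_locus H" "Zs d \<subseteq> zero_locus H"
        using Zd H(3) by blast+
    qed
    have gl: "dot g (lv i) = 0" if "i \<le> k" for i
      using L_sub that by (simp add: L_subset_zero_locus_iff flip: g)
    \<comment> \<open>Since \<open>H\<close> vanishes on \<open>L\<close>, it acts on the factor
      \<open>q\<close> alone.\<close>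
    have "act H M = 0"
      unfolding g[symmetric] M_def
      by (intro act_lin_prod_0 act_lin_power_0) (simp add: act_lin_lin gl)
    then have actF: "act H F = M * lin p"
      using act_lin_mult[of g M q] by (simp add: FM g p)
    \<comment> \<open>For \<open>p = 0\<close> the assumption
      \<open>dual_point (act H q) \<notin> L\<close> would hold trivially, as \<open>{0}\<close> is
      not a point; conciseness excludes this.\<close>
    have "p \<noteq> 0"
    proof
      assume "p = 0"
      then have "H \<in> Ann F \<inter> forms 1" using actF H(1) by (simp add: Ann_def)
      then show False using concise H(2) by (simp only: concise_def) blast
    qed
    then have p_notin: "p \<notin> vec.span (lv ` {..k})"
      using H(4) by (simp add: L' p dual_point_eq proj_point_in_proj_space proj_point_subset_iff)
    have Zs_props: "transversal (Zs i) \<and> Zs i \<subseteq> proj_space \<and> finite (Zs i) \<and> card (Zs i) = CARD('v) - Suc k"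
      if i: "i \<in> {1..d - 1}" for i
    proof -
      have "Zs i \<subseteq> Z" using i by (intro sub) auto
      then have "finite (Zs i)" "Zs i \<subseteq> proj_space" using Z finite_subset by auto
      then show ?thesis using Zs i transversal_if unfolding splitting_def by blast
    qed
    obtain h where h: "\<And>i z. i \<in> {1..d - 1} \<Longrightarrow> z \<in> Zs i \<Longrightarrow>
        \<exists>j\<in>{1..d - 1}. dot (h j) (repr z) = 0"
      and nz: "act (\<Prod>j=1..d - 1. lin (h j)) (M * lin p) \<noteq> 0"
      using ex_lin_product_nonzero[of Zs p, OF k a Zs_props p_notin] by blast
    \<comment> \<open>\<open>H\<close> itself covers \<open>Zs d\<close>, which completes the
      product to one vanishing on all of \<open>Z\<close>.\<close>
    define h' where "h' = h(d := g)"
    have eq: "{1..d} = insert d {1..d - 1}" "d \<notin> {1..d - 1}" using d3 by auto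
    have "(\<Prod>j\<in>{1..d}. lin (h' j)) \<in> vanishing_ideal Z"
    proof (rule prod_lin_in_vanishing_ideal[OF _ Z(2)])
      fix z assume "z \<in> Z"
      then obtain i where i: "i \<in> {1..d}" "z \<in> Zs i" using Zs by (auto simp: splitting_def)
      show "\<exists>j\<in>{1..d}. dot (h' j) (repr z) = 0"
      proof (cases "i = d")
        case True
        then have "dot g (repr z) = 0" using Zd_sub i(2) by (auto simp: zero_locus_lin_iff simp flip: g)
        then show ?thesis using d3 by (intro bexI[of _ d]) (auto simp: h'_def)
      next
        case False
        then have "i \<in> {1..d - 1}" using i(1) unfolding eq(1) by blast
        then obtain j where "j \<in> {1..d - 1}" "dot (h j) (repr z) = 0"
          using h i(2) by blast
        then show ?thesis using eq by (intro bexI[of _ j]) (auto simp: h'_def)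
      qed
    qed simp
    moreover have "(\<Prod>j\<in>{1..d}. lin (h' j)) = (\<Prod>j=1..d - 1. lin (h j)) * H"
    proof -
      have "(\<Prod>j=1..d - 1. lin (h' j)) = (\<Prod>j=1..d - 1. lin (h j))"
        using eq(2) by (intro prod.cong) (auto simp: h'_def)
      then show ?thesis unfolding eq(1) using eq(2) by (simp add: h'_def g mult.commute)
    qed
    ultimately have "(\<Prod>j=1..d - 1. lin (h j)) * H \<in> Ann F" using ann by auto
    then show False using nz actF by (simp add: Ann_def act_mult)
  qed

  show ?thesis
    unfolding codim using splitting srk psrk not_ann dim_L by auto
qed

end
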